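(* Let $\mathcal{A}$ be a unital $C^*$-algebra over $\mathbb{F}$, where $\mathbb{F}=\mathbb{R}$ or $\mathbb{C}$. Let $a\in\mathcal{A}$ and let $\mathcal{B}$ be a subspace of $\mathcal{A}$. Then $a$ is Birkhoff-James orthogonal to $\mathcal{B}$ if and only if there exists a state $\phi$ on $\mathcal{A}$ such that $\phi(a^*a)=\|a\|^2$ and $\phi(a^*b)=0$ for all $b\in\mathcal{B}$.
   Context: $1_{\mathcal{A}}$ denotes the identity of $\mathcal{A}$. "Subspace" means $\mathbb{F}$-linear subspace (not assumed closed). The element $a$ is Birkhoff-James orthogonal to $\mathcal{B}$ if $\|a\|\le\|a+b\|$ for all $b\in\mathcal{B}$. For $\mathbb{F}=\mathbb{C}$, a state on $\mathcal{A}$ is a positive linear functional $\phi$ on $\mathcal{A}$ (i.e. mapping positive elements to nonnegative reals) with $\phi(1_{\mathcal{A}})=1$; for $\mathbb{F}=\mathbb{R}$, it is additionally required that $\phi(c^* )=\phi(c)$ for all $c\in\mathcal{A}$. *)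

theory Defs
  imports "HOL-Analysis.Analysis"
begin

definition two_sided_unit :: "'a::monoid_mult \<Rightarrow> bool"
  where "two_sided_unit x \<longleftrightarrow> (\<exists>y. x * y = 1 \<and> y * x = 1)"

text \<open>
  The part of the structure common to the real and the complex case: a unital Banach algebra with
  an involution satisfying the \<open>C\<^sup>*\<close>-identity.  The superclass
  \<^class>\<open>real_normed_algebra_1\<close> includes \<open>1 \<noteq> 0\<close>, so the zero algebra, which has no states,
  is excluded.
\<close>

class cstar_normed_algebra = real_normed_algebra_1 + banach +
  fixes adj :: "'a \<Rightarrow> 'a"
  assumes adj_adj: "adj (adj x) = x"
    and adj_add: "adj (x + y) = adj x + adj y"
    and adj_scaleR: "adj (r *\<^sub>R x) = r *\<^sub>R adj x"
    and adj_mult: "adj (x * y) = adj y * adj x"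
    and cstar_identity: "norm (adj x * x) = (norm x)\<^sup>2"

text \<open>
  Over the reals the \<open>C\<^sup>*\<close>-identity alone does not characterise norm-closed self-adjoint algebras
  of operators on a Hilbert space (the complex numbers with the trivial involution satisfy it); as
  usual, a real \<open>C\<^sup>*\<close>-algebra is also required to have all elements \<open>1 + x\<^sup>* x\<close> invertible.
\<close>

class real_cstar_algebra = cstar_normed_algebra +
  assumes one_plus_adj_mult_invertible:
    "\<exists>y. (1 + adj x * x) * y = 1 \<and> y * (1 + adj x * x) = 1"

class complex_cstar_algebra = cstar_normed_algebra +
  fixes scaleC :: "complex \<Rightarrow> 'a \<Rightarrow> 'a"  (infixr \<open>*\<^sub>C\<close> 75)
  assumes scaleC_add_right: "c *\<^sub>C (x + y) = c *\<^sub>C x + c *\<^sub>C y"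
    and scaleC_add_left: "(c + d) *\<^sub>C x = c *\<^sub>C x + d *\<^sub>C x"
    and scaleC_scaleC: "c *\<^sub>C d *\<^sub>C x = (c * d) *\<^sub>C x"
    and scaleC_of_real: "complex_of_real r *\<^sub>C x = r *\<^sub>R x"
    and mult_scaleC_left: "(c *\<^sub>C x) * y = c *\<^sub>C (x * y)"
    and mult_scaleC_right: "x * (c *\<^sub>C y) = c *\<^sub>C (x * y)"
    and norm_scaleC: "norm (c *\<^sub>C x) = cmod c * norm x"
    and adj_scaleC: "adj (c *\<^sub>C x) = cnj c *\<^sub>C adj x"

lemma vector_space_scaleC:
  "vector_space (scaleC :: complex \<Rightarrow> 'a \<Rightarrow> 'a::complex_cstar_algebra)"
  by unfold_locales
    (simp_all add: scaleC_add_right scaleC_add_left scaleC_scaleC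
      scaleC_of_real[of 1, simplified])

abbreviation complex_subspace :: "'a::complex_cstar_algebra set \<Rightarrow> bool"
  where "complex_subspace \<equiv> module.subspace scaleC"

abbreviation complex_linear :: "('a::complex_cstar_algebra \<Rightarrow> complex) \<Rightarrow> bool"
  where "complex_linear \<equiv> Vector_Spaces.linear scaleC (*)"

text \<open>
  The spectrum of an element of a real algebra is its spectrum in the complexification:
  \<open>s + \<i>t\<close> belongs to it iff \<open>(x - s)\<^sup>2 + t\<^sup>2 = (x - (s + \<i>t)) (x - (s - \<i>t))\<close> is not invertible.
\<close>

definition real_spectrum :: "'a::real_cstar_algebra \<Rightarrow> complex set"
  where "real_spectrum x =
    {z. \<not> two_sided_unit ((x - of_real (Re z))\<^sup>2 + of_real ((Im z)\<^sup>2))}"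

definition complex_spectrum :: "'a::complex_cstar_algebra \<Rightarrow> complex set"
  where "complex_spectrum x = {z. \<not> two_sided_unit (x - z *\<^sub>C 1)}"

definition real_positive :: "'a::real_cstar_algebra \<Rightarrow> bool"
  where "real_positive x \<longleftrightarrow> adj x = x \<and> real_spectrum x \<subseteq> \<real>\<^sub>\<ge>\<^sub>0"

definition complex_positive :: "'a::complex_cstar_algebra \<Rightarrow> bool"
  where "complex_positive x \<longleftrightarrow> adj x = x \<and> complex_spectrum x \<subseteq> \<real>\<^sub>\<ge>\<^sub>0"

definition real_state :: "('a::real_cstar_algebra \<Rightarrow> real) \<Rightarrow> bool"
  where "real_state \<phi> \<longleftrightarrow>
    linear \<phi> \<and> (\<forall>x. real_positive x \<longrightarrow> \<phi> x \<ge> 0) \<and> \<phi> 1 = 1 \<and> (\<forall>c. \<phi> (adj c) = \<phi> c)"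

definition complex_state :: "('a::complex_cstar_algebra \<Rightarrow> complex) \<Rightarrow> bool"
  where "complex_state \<phi> \<longleftrightarrow>
    complex_linear \<phi> \<and> (\<forall>x. complex_positive x \<longrightarrow> \<phi> x \<in> \<real>\<^sub>\<ge>\<^sub>0) \<and> \<phi> 1 = 1"

definition birkhoff_james_orthogonal :: "'a::real_normed_vector \<Rightarrow> 'a set \<Rightarrow> bool"
  where "birkhoff_james_orthogonal a B \<longleftrightarrow> (\<forall>b\<in>B. norm a \<le> norm (a + b))"

end

theory Submission
  imports Defs
begin

text \<open>
  If \<open>\<parallel>1 + a\<^sup>*a\<parallel> = 1 + \<parallel>a\<parallel>\<^sup>2\<close>, a functional \<open>f\<close> of norm at most one with
  \<open>f (1 + a\<^sup>*a) = \<parallel>1 + a\<^sup>*a\<parallel>\<close> automatically satisfies \<open>f 1 = 1\<close> and \<open>f (a\<^sup>*a) = \<parallel>a\<parallel>\<^sup>2\<close>, hence is the real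
  part of a state.  By Hahn-Banach it can be chosen to vanish on \<open>a\<^sup>*B\<close> as soon as \<open>1 + a\<^sup>*a\<close> is
  orthogonal to \<open>a\<^sup>*B\<close>, which follows from \<open>\<parallel>1 + x\<^sup>*x\<parallel> = 1 + \<parallel>x\<parallel>\<^sup>2\<close> for \<open>x = a + \<epsilon>b\<close> and a convexity
  argument in \<open>\<epsilon>\<close>.  The norm identity says that \<open>\<parallel>x\<parallel>\<^sup>2\<close> lies in the spectrum of \<open>x\<^sup>*x\<close>: a self-adjoint
  element attains its norm in its spectrum up to sign, and the sign is positive for \<open>x\<^sup>*x\<close>.
  Conversely, a state with the stated properties gives
  \<open>\<parallel>a\<parallel> \<parallel>a + b\<parallel> \<ge> Re (\<phi> (a\<^sup>*(a + b))) = \<parallel>a\<parallel>\<^sup>2\<close>.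
\<close>

section \<open>Invertible elements of a Banach algebra\<close>

lemma two_sided_unitI: "x * y = 1 \<Longrightarrow> y * x = 1 \<Longrightarrow> two_sided_unit x"
  unfolding two_sided_unit_def by blast

lemma two_sided_unit_mult:
  assumes "two_sided_unit x" "two_sided_unit y"
  shows "two_sided_unit (x * y)"
proof -
  from assms obtain x' y' where "x * x' = 1" "x' * x = 1" "y * y' = 1" "y' * y = 1"
    unfolding two_sided_unit_def by blast
  then have "x * y * (y' * x') = 1" "y' * x' * (x * y) = 1"
    by (metis mult.assoc mult_1_left)+
  then show ?thesis by (rule two_sided_unitI)
qed

text \<open>An inverse \<open>w\<close> of \<open>x * y\<close> makes \<open>y * w\<close> a right
  inverse of \<open>x\<close> and, by commutation, \<open>w * y\<close> a left inverse; the two must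
  agree.\<close>

lemma two_sided_unit_commuting_factor:
  assumes "x * y = y * x" "two_sided_unit (x * y)"
  shows "two_sided_unit x"
proof -
  from assms(2) obtain w where w: "x * y * w = 1" "w * (x * y) = 1"
    unfolding two_sided_unit_def by blast
  have r: "x * (y * w) = 1" using w by (simp add: mult.assoc)
  have l: "(w * y) * x = 1" using w assms(1) by (simp add: mult.assoc)
  have "w * y = y * w" using l r by (metis mult.assoc mult_1_left mult_1_right)
  with l r show ?thesis by (intro two_sided_unitI) auto
qed

lemma two_sided_unit_scaleR_iff:
  fixes x :: "'a::real_normed_algebra_1"
  assumes "r \<noteq> 0"
  shows "two_sided_unit (r *\<^sub>R x) \<longleftrightarrow> two_sided_unit x"
proof -
  have *: "two_sided_unit (s *\<^sub>R y)" if "s \<noteq> 0" "two_sided_unit y" for s and y :: 'a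
  proof -
    from that(2) obtain z where "y * z = 1" "z * y = 1" unfolding two_sided_unit_def by blast
    with that(1) show ?thesis by (intro two_sided_unitI[of _ "inverse s *\<^sub>R z"]) auto
  qed
  show ?thesis using *[of r x] *[of "inverse r" "r *\<^sub>R x"] assms by auto
qed

lemma two_sided_unit_minus_iff:
  fixes x :: "'a::real_normed_algebra_1"
  shows "two_sided_unit (- x) \<longleftrightarrow> two_sided_unit x"
  using two_sided_unit_scaleR_iff[of "-1" x] by simp

text \<open>The inverse is the Neumann series; multiplying it by \<open>1 - x\<close> on either side
  telescopes.\<close>

lemma two_sided_unit_one_minus:
  fixes x :: "'a::{real_normed_algebra_1,banach}"
  assumes "norm x < 1"
  shows "two_sided_unit (1 - x)"
proof -
  have s: "summable (\<lambda>n. x ^ n)" by (rule complete_algebra_summable_geometric) fact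
  have tele: "(\<lambda>n. x ^ n - x ^ Suc n) sums 1"
    using telescope_sums'[OF summable_LIMSEQ_zero[OF s]] by simp
  have "(\<lambda>n. (1 - x) * x ^ n) sums ((1 - x) * (\<Sum>n. x ^ n))"
    using s by (intro sums_mult summable_sums)
  with tele have "(1 - x) * (\<Sum>n. x ^ n) = 1"
    by (intro sums_unique2[OF _ tele]) (simp add: left_diff_distrib)
  moreover have "(\<lambda>n. x ^ n * (1 - x)) sums ((\<Sum>n. x ^ n) * (1 - x))"
    using s by (intro sums_mult2 summable_sums)
  then have "(\<Sum>n. x ^ n) * (1 - x) = 1"
    by (intro sums_unique2[OF _ tele]) (simp add: right_diff_distrib power_commutes)
  ultimately show ?thesis by (rule two_sided_unitI)
qed

lemma two_sided_unit_of_real_minus: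
  fixes x :: "'a::{real_normed_algebra_1,banach}"
  assumes "norm x < \<bar>r\<bar>"
  shows "two_sided_unit (of_real r - x)"
proof -
  have r: "r \<noteq> 0" using assms norm_ge_zero[of x] by auto
  have "norm (inverse r *\<^sub>R x) < 1" using assms r by (simp add: field_simps)
  then have "two_sided_unit (r *\<^sub>R (1 - inverse r *\<^sub>R x))"
    using two_sided_unit_one_minus two_sided_unit_scaleR_iff r by blast
  then show ?thesis using r by (simp add: algebra_simps of_real_def)
qed

lemma two_sided_unit_near:
  fixes x :: "'a::{real_normed_algebra_1,banach}"
  assumes "two_sided_unit x"
  obtains \<delta> where "\<delta> > 0" "\<And>d::'a. norm d < \<delta> \<Longrightarrow> two_sided_unit (x + d)"
proof -
  from assms obtain y where y: "x * y = 1" "y * x = 1" unfolding two_sided_unit_def by blast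
  have y0: "norm y > 0" using y by auto
  show ?thesis
  proof (rule that[of "1 / norm y"])
    show "1 / norm y > 0" using y0 by simp
    fix d :: 'a assume "norm d < 1 / norm y"
    then have "norm y * norm d < 1" using y0 by (simp add: field_simps)
    then have "norm (- (y * d)) < 1" using norm_mult_ineq[of y d] by simp
    then have "two_sided_unit (x * (1 - - (y * d)))"
      using assms by (intro two_sided_unit_mult two_sided_unit_one_minus)
    \<comment> \<open>Factoring out \<open>x\<close> reduces the perturbation to one of
      \<open>1\<close>, whence the radius \<open>1 / norm y\<close>.\<close>
    moreover have "x * (1 - - (y * d)) = x + d"
      using y by (simp add: distrib_left mult.assoc[symmetric])
    ultimately show "two_sided_unit (x + d)" by simp
  qed
qed

text \<open>The spectra of \<open>x * y\<close> and \<open>y * x\<close> agree away from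
  zero.\<close>

lemma two_sided_unit_swap:
  fixes x y :: "'a::real_normed_algebra_1"
  assumes "r \<noteq> 0" "two_sided_unit (of_real r - x * y)"
  shows "two_sided_unit (of_real r - y * x)"
proof -
  from assms(2) obtain w where w: "(of_real r - x * y) * w = 1" "w * (of_real r - x * y) = 1"
    unfolding two_sided_unit_def by blast
  have w1: "x * (y * w) = r *\<^sub>R w - 1" and w2: "w * (x * y) = r *\<^sub>R w - 1"
    using w by (auto simp: algebra_simps of_real_def)
  \<comment> \<open>Jacobson's formula: expand the inverse of \<open>r - y * x\<close> as a
    geometric series and resum its tail through \<open>w\<close>.\<close>
  let ?v = "inverse r *\<^sub>R (1 + y * w * x)"
  have e1: "y * (x * (y * (w * x))) = r *\<^sub>R (y * (w * x)) - y * x"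
    using arg_cong[OF w1, of "\<lambda>t. y * (t * x)"] by (simp add: algebra_simps)
  have e2: "y * (w * (x * (y * x))) = r *\<^sub>R (y * (w * x)) - y * x"
    using arg_cong[OF w2, of "\<lambda>t. y * (t * x)"] by (simp add: algebra_simps)
  have "(of_real r - y * x) * ?v = 1"
    using assms(1) by (simp add: algebra_simps of_real_def e1)
  moreover have "?v * (of_real r - y * x) = 1"
    using assms(1) by (simp add: algebra_simps of_real_def e2)
  ultimately show ?thesis by (rule two_sided_unitI)
qed

section \<open>Continuity of inversion\<close>

definition unit_inverse :: "'a::monoid_mult \<Rightarrow> 'a"
  where "unit_inverse x = (SOME y. x * y = 1 \<and> y * x = 1)"

lemma unit_inverse:
  assumes "two_sided_unit x"
  shows "x * unit_inverse x = 1" "unit_inverse x * x = 1"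
  using someI_ex[OF assms[unfolded two_sided_unit_def]] unfolding unit_inverse_def by auto

lemma continuous_on_unit_inverse:
  fixes f :: "'b::metric_space \<Rightarrow> 'a::real_normed_algebra_1"
  assumes cont: "continuous_on S f" and unit: "\<And>s. s \<in> S \<Longrightarrow> two_sided_unit (f s)"
  shows "continuous_on S (\<lambda>s. unit_inverse (f s))"
  unfolding continuous_on_def
proof
  fix s assume s: "s \<in> S"
  define b where "b = (\<lambda>t. unit_inverse (f t))"
  have lim: "((\<lambda>t. norm (f t - f s)) \<longlongrightarrow> 0) (at s within S)"
    using cont s unfolding continuous_on_def by (metis LIM_zero tendsto_norm_zero)
  have diff: "norm (b t - b s) \<le> norm (b t) * norm (f t - f s) * norm (b s)" if "t \<in> S" for t
  proof -
    have "b t - b s = b t * (f s - f t) * b s"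
      using unit_inverse[OF unit[OF s]] unit_inverse[OF unit[OF that]]
      by (simp add: b_def algebra_simps flip: mult.assoc)
        (simp add: mult.assoc)
    also have "norm \<dots> \<le> norm (b t * (f s - f t)) * norm (b s)" by (rule norm_mult_ineq)
    also have "\<dots> \<le> norm (b t) * norm (f s - f t) * norm (b s)"
      by (intro mult_right_mono norm_mult_ineq) simp
    finally show ?thesis by (simp add: norm_minus_commute)
  qed
  have "b s \<noteq> 0" using unit_inverse[OF unit[OF s]] by (auto simp: b_def)
  \<comment> \<open>The threshold gives \<open>norm (b t - b s) \<le> norm (b t) / 2\<close>, so
    \<open>norm (b t)\<close> stays below twice \<open>norm (b s)\<close>; the bound
    \<open>diff\<close> then becomes linear in \<open>norm (f t - f s)\<close>.\<close>
  then have "\<forall>\<^sub>F t in at s within S. norm (f t - f s) < 1 / (2 * norm (b s))"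
    by (intro order_tendstoD[OF lim]) simp
  moreover have "\<forall>\<^sub>F t in at s within S. t \<in> S"
    unfolding eventually_at_topological by (rule exI[of _ UNIV]) simp
  ultimately have ev: "\<forall>\<^sub>F t in at s within S.
      norm (b t - b s) \<le> 2 * (norm (b s))\<^sup>2 * norm (f t - f s)"
  proof eventually_elim
    case (elim t)
    define u v d where "u = norm (b t)" and "v = norm (b s)" and "d = norm (f t - f s)"
    have pos: "u \<ge> 0" "v > 0" "d \<ge> 0" using \<open>b s \<noteq> 0\<close> by (auto simp: u_def v_def d_def)
    have dv: "d * v \<le> 1 / 2" using elim(1) pos by (simp add: field_simps flip: d_def v_def)
    have le: "norm (b t - b s) \<le> u * (d * v)"
      using diff[OF elim(2)] by (simp add: u_def v_def d_def mult.assoc)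
    also have "\<dots> \<le> u * (1 / 2)" using pos dv by (intro mult_left_mono)
    finally have "u \<le> 2 * v"
      using norm_triangle_sub[of "b t" "b s"] by (simp add: u_def v_def)
    then have "u * (d * v) \<le> 2 * v * (d * v)" using pos by (intro mult_right_mono) auto
    with le show ?case by (simp add: v_def d_def power2_eq_square mult_ac)
  qed
  have "((\<lambda>t. b t - b s) \<longlongrightarrow> 0) (at s within S)"
    by (rule Lim_null_comparison[OF ev]) (use tendsto_mult_right_zero[OF lim] in blast)
  then show "((\<lambda>t. unit_inverse (f t)) \<longlongrightarrow> unit_inverse (f s)) (at s within S)"
    unfolding b_def by (rule LIM_zero_cancel)
qed

section \<open>The Hahn-Banach theorem for sublinear functionals\<close>

definition sublinear :: "('a::real_vector \<Rightarrow> real) \<Rightarrow> bool"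
  where "sublinear p \<longleftrightarrow>
    (\<forall>x y. p (x + y) \<le> p x + p y) \<and> (\<forall>t x. t \<ge> 0 \<longrightarrow> p (t *\<^sub>R x) = t * p x)"

lemma sublinear_add: "sublinear p \<Longrightarrow> p (x + y) \<le> p x + p y"
  and sublinear_scaleR: "sublinear p \<Longrightarrow> t \<ge> 0 \<Longrightarrow> p (t *\<^sub>R x) = t * p x"
  by (auto simp: sublinear_def)

lemma sublinear_zero: "sublinear p \<Longrightarrow> p 0 = 0"
  using sublinear_scaleR[of p 0 0] by simp

lemma sublinear_neg: "sublinear p \<Longrightarrow> - p (- x) \<le> p x"
  using sublinear_add[of p x "- x"] sublinear_zero[of p] by simp

lemma sublinearI_pos:
  assumes "\<And>x y. p (x + y) \<le> p x + p y" and "p 0 = 0"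
    and le: "\<And>t x. t > 0 \<Longrightarrow> p (t *\<^sub>R x) \<le> t * p x"
  shows "sublinear p"
proof -
  have "p (t *\<^sub>R x) = t * p x" if "t \<ge> 0" for t x
  proof (cases "t = 0")
    case False
    with that have t: "t > 0" by simp
    have "p x \<le> inverse t * p (t *\<^sub>R x)"
      using le[of "inverse t" "t *\<^sub>R x"] t by simp
    then have "t * p x \<le> p (t *\<^sub>R x)" using t by (simp add: field_simps)
    with le[OF t, of x] show ?thesis by simp
  qed (use assms in simp)
  then show ?thesis using assms by (simp add: sublinear_def)
qed

text \<open>The value of \<open>p\<close> at \<open>y\<close> becomes a lower bound for every linear functional below \<open>tighten p y\<close>.\<close>

definition tighten :: "('a::real_vector \<Rightarrow> real) \<Rightarrow> 'a \<Rightarrow> 'a \<Rightarrow> real"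
  where "tighten p y x = (INF t\<in>{0..}. p (x + t *\<^sub>R y) - t * p y)"

lemma tighten_bdd:
  assumes "sublinear p"
  shows "bdd_below ((\<lambda>t. p (x + t *\<^sub>R y) - t * p y) ` {0..})"
proof (intro bdd_belowI2)
  fix t :: real assume "t \<in> {0..}"
  then show "- p (- x) \<le> p (x + t *\<^sub>R y) - t * p y"
    using sublinear_add[OF assms, of "x + t *\<^sub>R y" "- x"] sublinear_scaleR[OF assms, of t y] by simp
qed

lemma tighten_le:
  assumes "sublinear p" "t \<ge> 0"
  shows "tighten p y x \<le> p (x + t *\<^sub>R y) - t * p y"
  unfolding tighten_def using assms by (intro cINF_lower tighten_bdd) auto

lemma tighten_less:
  assumes "sublinear p" "e > 0"
  obtains t where "t \<ge> 0" "p (x + t *\<^sub>R y) - t * p y < tighten p y x + e"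
proof -
  have "(INF t\<in>{0..}. p (x + t *\<^sub>R y) - t * p y) < tighten p y x + e"
    using assms by (simp add: tighten_def)
  then show ?thesis
    using that by (subst (asm) cINF_less_iff[OF _ tighten_bdd[OF assms(1)]]) auto
qed

lemma sublinear_tighten:
  assumes p: "sublinear p"
  shows "sublinear (tighten p y)"
proof (rule sublinearI_pos)
  fix x x'
  show "tighten p y (x + x') \<le> tighten p y x + tighten p y x'"
  proof (rule field_le_epsilon)
    fix e :: real assume e: "e > 0"
    obtain t where t: "t \<ge> 0" "p (x + t *\<^sub>R y) - t * p y < tighten p y x + e / 2"
      using tighten_less[OF p, of "e / 2"] e by (metis half_gt_zero)
    obtain t' where t': "t' \<ge> 0" "p (x' + t' *\<^sub>R y) - t' * p y < tighten p y x' + e / 2"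
      using tighten_less[OF p, of "e / 2"] e by (metis half_gt_zero)
    have "tighten p y (x + x') \<le> p (x + x' + (t + t') *\<^sub>R y) - (t + t') * p y"
      using t t' by (intro tighten_le p) auto
    moreover have "p (x + x' + (t + t') *\<^sub>R y) \<le> p (x + t *\<^sub>R y) + p (x' + t' *\<^sub>R y)"
      using sublinear_add[OF p, of "x + t *\<^sub>R y" "x' + t' *\<^sub>R y"] by (simp add: algebra_simps)
    ultimately show "tighten p y (x + x') \<le> tighten p y x + tighten p y x' + e"
      using t t' by (simp add: algebra_simps)
  qed
next
  have "tighten p y 0 \<ge> 0" unfolding tighten_def
    by (rule cINF_greatest) (auto simp: sublinear_scaleR[OF p])
  moreover have "tighten p y 0 \<le> 0"
    using tighten_le[OF p, of 0] sublinear_zero[OF p] by (metis add_0 diff_zero mult_zero_left order_refl scaleR_zero_left)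
  ultimately show "tighten p y 0 = 0" by simp
next
  fix s :: real and x assume s: "s > 0"
  show "tighten p y (s *\<^sub>R x) \<le> s * tighten p y x"
  proof (rule field_le_epsilon)
    fix e :: real assume e: "e > 0"
    obtain t where t: "t \<ge> 0" "p (x + t *\<^sub>R y) - t * p y < tighten p y x + e / s"
      using tighten_less[OF p, of "e / s"] e s by (metis divide_pos_pos)
    have "tighten p y (s *\<^sub>R x) \<le> p (s *\<^sub>R x + (s * t) *\<^sub>R y) - s * t * p y"
      using s t by (intro tighten_le p) auto
    also have "\<dots> = s * (p (x + t *\<^sub>R y) - t * p y)"
      using sublinear_scaleR[OF p, of s "x + t *\<^sub>R y"] s by (simp add: algebra_simps)
    also have "\<dots> \<le> s * tighten p y x + e"
      using t s by (simp add: field_simps)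
    finally show "tighten p y (s *\<^sub>R x) \<le> s * tighten p y x + e" .
  qed
qed

lemma tighten_le_self: "sublinear p \<Longrightarrow> tighten p y x \<le> p x"
  using tighten_le[of p 0 y x] by simp

lemma tighten_neg: "sublinear p \<Longrightarrow> tighten p y (- y) \<le> - p y"
  using tighten_le[of p 1 y "- y"] by (simp add: sublinear_zero)

text \<open>Minimality forces \<open>tighten p y = p\<close>; the parameter \<open>1\<close> in the
  infimum then gives \<open>p x \<le> p (x + y) - p y\<close>, so \<open>p\<close> is superadditive
  as well.\<close>

lemma linear_minimal_sublinear:
  assumes p: "sublinear p" and min: "\<And>q. sublinear q \<Longrightarrow> q \<le> p \<Longrightarrow> q = p"
  shows "linear p"
proof -
  have "tighten p y = p" for y
    using p by (intro min sublinear_tighten) (auto simp: le_fun_def tighten_le_self)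
  then have add: "p (x + y) = p x + p y" for x y
    using tighten_le[OF p, of 1 y x] sublinear_add[OF p, of x y] by simp
  have neg: "p (- x) = - p x" for x
    using add[of x "- x"] sublinear_zero[OF p] by simp
  have "p (t *\<^sub>R x) = t * p x" for t x
    using sublinear_scaleR[OF p, of t x] sublinear_scaleR[OF p, of "- t" x] neg[of "t *\<^sub>R x"]
    by (cases "t \<ge> 0") auto
  with add show ?thesis by (intro linearI) auto
qed

text \<open>The bound \<open>- p (- x) \<le> q x\<close> keeps the infimum finite. Subadditivity
  needs the chain: near-minimisers at \<open>x\<close> and at \<open>y\<close> have a common lower
  bound inside \<open>C\<close>.\<close>

lemma sublinear_chain_INF:
  assumes C: "C \<noteq> {}" "\<And>q. q \<in> C \<Longrightarrow> sublinear q \<and> q \<le> p"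
    and chain: "\<And>q q'. q \<in> C \<Longrightarrow> q' \<in> C \<Longrightarrow> q \<le> q' \<or> q' \<le> q"
  shows "sublinear (\<lambda>x. INF q\<in>C. q x)" "\<And>q x. q \<in> C \<Longrightarrow> (INF q\<in>C. q x) \<le> q x"
proof -
  have bdd: "bdd_below ((\<lambda>q. q x) ` C)" for x
  proof (intro bdd_belowI2)
    fix q assume "q \<in> C"
    with C have "sublinear q" "q (- x) \<le> p (- x)" by (auto simp: le_fun_def)
    then show "- p (- x) \<le> q x" using sublinear_neg[of q x] by simp
  qed
  show lower: "(INF q\<in>C. q x) \<le> q x" if "q \<in> C" for q x
    using that by (intro cINF_lower bdd)
  have approx: "\<exists>q\<in>C. q x < (INF q\<in>C. q x) + e" if "e > 0" for e x
    using cINF_less_iff[OF C(1) bdd, of x "(INF q\<in>C. q x) + e"] that by simp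
  show "sublinear (\<lambda>x. INF q\<in>C. q x)"
  proof (rule sublinearI_pos)
    fix x y
    show "(INF q\<in>C. q (x + y)) \<le> (INF q\<in>C. q x) + (INF q\<in>C. q y)"
    proof (rule field_le_epsilon)
      fix e :: real assume e: "e > 0"
      obtain q where q: "q \<in> C" "q x < (INF q\<in>C. q x) + e / 2" using approx[of "e / 2"] e by auto
      obtain q' where q': "q' \<in> C" "q' y < (INF q\<in>C. q y) + e / 2" using approx[of "e / 2"] e by auto
      obtain r where r: "r \<in> C" "r \<le> q" "r \<le> q'" using chain[OF q(1) q'(1)] q(1) q'(1) by blast
      have "(INF q\<in>C. q (x + y)) \<le> r (x + y)" using r(1) by (rule lower)
      also have "\<dots> \<le> r x + r y" using C(2)[OF r(1)] by (simp add: sublinear_add)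
      also have "\<dots> \<le> q x + q' y" using r by (intro add_mono) (auto simp: le_fun_def)
      finally show "(INF q\<in>C. q (x + y)) \<le> (INF q\<in>C. q x) + (INF q\<in>C. q y) + e"
        using q q' by simp
    qed
  next
    have "(\<lambda>q. q 0) ` C = {0}" using C by (force simp: sublinear_zero)
    then show "(INF q\<in>C. q 0) = 0" by simp
  next
    fix t :: real and x assume t: "t > 0"
    show "(INF q\<in>C. q (t *\<^sub>R x)) \<le> t * (INF q\<in>C. q x)"
    proof (rule field_le_epsilon)
      fix e :: real assume e: "e > 0"
      obtain q where q: "q \<in> C" "q x < (INF q\<in>C. q x) + e / t"
        using approx[of "e / t"] e t by auto
      have "(INF q\<in>C. q (t *\<^sub>R x)) \<le> t * q x"
        using lower[OF q(1), of "t *\<^sub>R x"] C(2)[OF q(1)] t by (simp add: sublinear_scaleR)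
      also have "\<dots> \<le> t * (INF q\<in>C. q x) + e" using q t by (simp add: field_simps)
      finally show "(INF q\<in>C. q (t *\<^sub>R x)) \<le> t * (INF q\<in>C. q x) + e" .
    qed
  qed
qed

lemma hahn_banach_sublinear:
  assumes p: "sublinear p"
  shows "\<exists>f. linear f \<and> (\<forall>x. f x \<le> p x)"
proof -
  define S where "S = {q. sublinear q \<and> q \<le> p}"
  \<comment> \<open>The order is reversed, so that Zorn's lemma yields a pointwise minimal sublinear
    functional.\<close>
  define r where "r = {(q, q'). q \<in> S \<and> q' \<in> S \<and> q' \<le> q}"
  have F: "Field r = S" by (auto simp: Field_def r_def)
  have po: "Partial_order r"
    unfolding partial_order_on_def preorder_on_def refl_on_def trans_def antisym_def F
    by (auto simp: r_def)
  have "\<exists>m\<in>Field r. \<forall>q\<in>Field r. (m, q) \<in> r \<longrightarrow> q = m"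
  proof (rule Zorns_po_lemma[OF po])
    fix C assume C: "C \<in> Chains r"
    then have CS: "C \<subseteq> S" by (auto simp: Chains_def r_def)
    show "\<exists>u\<in>Field r. \<forall>q\<in>C. (q, u) \<in> r"
    proof (cases "C = {}")
      case True
      then show ?thesis using p by (auto simp: F S_def)
    next
      case False
      have sub: "\<And>q. q \<in> C \<Longrightarrow> sublinear q \<and> q \<le> p" using CS by (auto simp: S_def)
      have chain: "\<And>q q'. q \<in> C \<Longrightarrow> q' \<in> C \<Longrightarrow> q \<le> q' \<or> q' \<le> q"
        using C by (auto simp: Chains_def r_def)
      define u where "u = (\<lambda>x. INF q\<in>C. q x)"
      have u: "sublinear u" "\<And>q. q \<in> C \<Longrightarrow> u \<le> q"
        unfolding u_def le_fun_def using sublinear_chain_INF[OF False sub chain] by auto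
      have "u \<in> S" using u False sub by (fastforce simp: S_def intro: order_trans)
      then show ?thesis unfolding F using u CS by (auto simp: r_def)
    qed
  qed
  then obtain m where m: "m \<in> S" "\<And>q. q \<in> S \<Longrightarrow> q \<le> m \<Longrightarrow> q = m"
    unfolding F by (auto simp: r_def)
  have "linear m"
    using m by (intro linear_minimal_sublinear) (auto simp: S_def)
  with m show ?thesis by (auto simp: S_def le_fun_def)
qed

lemma hahn_banach_sublinear_at:
  assumes "sublinear p"
  obtains f where "linear f" "\<And>x. f x \<le> p x" "f y = p y"
proof -
  obtain f where f: "linear f" "\<And>x. f x \<le> tighten p y x"
    using hahn_banach_sublinear[OF sublinear_tighten[OF assms]] by blast
  have le: "f x \<le> p x" for x using f(2) tighten_le_self[OF assms] order_trans by blast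
  have "- f y \<le> - p y" using f(2)[of "- y"] tighten_neg[OF assms, of y] linear_neg[OF f(1), of y] by simp
  then have "f y = p y" using le[of y] by simp
  with that f(1) le show thesis by blast
qed

section \<open>Distance to a subspace and norming functionals\<close>

lemma sublinear_infdist_subspace:
  fixes W :: "'a::real_normed_vector set"
  assumes W: "subspace W"
  shows "sublinear (\<lambda>x. infdist x W)"
proof -
  have ne: "W \<noteq> {}" using subspace_0[OF W] by auto
  have le: "infdist x W \<le> norm (x - w)" if "w \<in> W" for x w
    using infdist_le[OF that, of x] by (simp add: dist_norm)
  have approx: "\<exists>w\<in>W. norm (x - w) < infdist x W + e" if "e > 0" for e x
    using that infdist_notempty[OF ne, of x] cINF_less_iff[OF ne, of "dist x" "infdist x W + e"]
    by (force simp: dist_norm intro!: bdd_belowI2[where m = 0])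
  show ?thesis
  proof (rule sublinearI_pos)
    fix x y
    show "infdist (x + y) W \<le> infdist x W + infdist y W"
    proof (rule field_le_epsilon)
      fix e :: real assume e: "e > 0"
      obtain v where v: "v \<in> W" "norm (x - v) < infdist x W + e / 2" using approx[of "e / 2"] e by auto
      obtain w where w: "w \<in> W" "norm (y - w) < infdist y W + e / 2" using approx[of "e / 2"] e by auto
      have "infdist (x + y) W \<le> norm (x + y - (v + w))"
        using v w W by (intro le subspace_add)
      also have "\<dots> \<le> norm (x - v) + norm (y - w)"
        using norm_triangle_ineq[of "x - v" "y - w"] by (simp add: algebra_simps)
      finally show "infdist (x + y) W \<le> infdist x W + infdist y W + e" using v w by simp
    qed
  next
    show "infdist 0 W = 0" using subspace_0[OF W] by (rule infdist_zero)
  next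
    fix t :: real and x assume t: "t > 0"
    show "infdist (t *\<^sub>R x) W \<le> t * infdist x W"
    proof (rule field_le_epsilon)
      fix e :: real assume e: "e > 0"
      obtain w where w: "w \<in> W" "norm (x - w) < infdist x W + e / t"
        using approx[of "e / t"] e t by auto
      have "infdist (t *\<^sub>R x) W \<le> norm (t *\<^sub>R x - t *\<^sub>R w)"
        using w W by (intro le subspace_scale)
      also have "\<dots> = t * norm (x - w)" using t by (simp flip: scaleR_diff_right)
      also have "\<dots> \<le> t * infdist x W + e" using w t by (simp add: field_simps)
      finally show "infdist (t *\<^sub>R x) W \<le> t * infdist x W + e" .
    qed
  qed
qed

text \<open>Dominating \<open>f\<close> by the distance to \<open>W\<close> does everything at once:
  the distance is at most the norm, it vanishes at \<open>w\<close> and \<open>- w\<close>, and by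
  hypothesis it equals \<open>norm u\<close> at \<open>u\<close>.\<close>

lemma norming_functional_annihilating_subspace:
  fixes u :: "'a::real_normed_vector"
  assumes W: "subspace W" and u: "\<And>w. w \<in> W \<Longrightarrow> norm u \<le> norm (u + w)"
  obtains f where "linear f" "\<And>x. f x \<le> norm x" "f u = norm u" "\<And>w. w \<in> W \<Longrightarrow> f w = 0"
proof -
  have W0: "0 \<in> W" using W by (rule subspace_0)
  obtain f where f: "linear f" "\<And>x. f x \<le> infdist x W" "f u = infdist u W"
    using hahn_banach_sublinear_at[OF sublinear_infdist_subspace[OF W]] by blast
  have le: "f x \<le> norm x" for x
    using f(2)[of x] infdist_le[OF W0, of x] by simp
  have "norm u \<le> infdist u W"
    using W0 u[of "- w" for w] subspace_neg[OF W]
    by (subst infdist_notempty) (auto intro!: cINF_greatest simp: dist_norm)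
  then have "f u = norm u" using f(3) le[of u] by simp
  moreover have "f w = 0" if "w \<in> W" for w
    using f(2)[of w] f(2)[of "- w"] that subspace_neg[OF W that] linear_neg[OF f(1), of w] by simp
  ultimately show thesis using that f(1) le by blast
qed

section \<open>Spectral radius of self-adjoint elements\<close>

lemma adj_one [simp]: "adj (1::'a::cstar_normed_algebra) = 1"
proof -
  have "adj (1::'a) = adj (adj 1 * 1)" by (metis adj_adj adj_mult mult_1_right)
  then show ?thesis by (simp add: adj_adj)
qed

lemma adj_minus: "adj (- x) = - adj (x::'a::cstar_normed_algebra)"
  using adj_scaleR[of "-1" x] by simp

lemma adj_diff: "adj (x - y) = adj x - adj (y::'a::cstar_normed_algebra)"
  using adj_add[of x "- y"] by (simp add: adj_minus)

lemma adj_of_real [simp]: "adj (of_real r :: 'a::cstar_normed_algebra) = of_real r"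
  by (simp add: of_real_def adj_scaleR)

lemmas adj_simps = adj_adj adj_add adj_minus adj_diff adj_scaleR adj_mult

lemma norm_adj [simp]: "norm (adj x) = norm (x::'a::cstar_normed_algebra)"
proof -
  have le: "norm y \<le> norm (adj y)" for y :: 'a
  proof (cases "y = 0")
    case False
    have "norm y * norm y \<le> norm (adj y) * norm y"
      using norm_mult_ineq[of "adj y" y] by (simp add: cstar_identity power2_eq_square)
    with False show ?thesis by simp
  qed simp
  from le[of x] le[of "adj x"] show ?thesis by (simp add: adj_adj)
qed

lemma norm_self_adjoint_square:
  "adj h = h \<Longrightarrow> norm (h * h) = (norm (h::'a::cstar_normed_algebra))\<^sup>2"
  using cstar_identity[of h] by simp

lemma norm_self_adjoint_power:
  fixes h :: "'a::cstar_normed_algebra"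
  shows "adj h = h \<Longrightarrow> norm (h ^ 2 ^ n) = norm h ^ 2 ^ n"
proof (induction n arbitrary: h)
  case (Suc n)
  then have "norm ((h * h) ^ 2 ^ n) = norm (h * h) ^ 2 ^ n" by (simp add: adj_mult)
  with Suc.prems show ?case
    by (simp only: power_Suc power_mult power2_eq_square[symmetric]
        norm_self_adjoint_square[OF Suc.prems, folded power2_eq_square])
qed simp

text \<open>The common ground of the two scalar fields. After shifting and scaling, the axiom says
  that self-adjoint elements have real spectrum; the real and the complex algebras are both shown to
  be instances.\<close>

class hermitian_cstar_algebra = cstar_normed_algebra +
  assumes one_plus_square_invertible:
    "adj h = h \<Longrightarrow> \<exists>y. (1 + h * h) * y = 1 \<and> y * (1 + h * h) = 1"

lemma one_plus_square_unit:
  "adj h = h \<Longrightarrow> two_sided_unit (1 + h * h)" for h :: "'a::hermitian_cstar_algebra"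
  using one_plus_square_invertible unfolding two_sided_unit_def .

text \<open>
  \<open>resolvent_re w z\<close> is the real part \<open>(1 - (Re z) w) / ((1 - z w) (1 - cnj z w))\<close> of
  the resolvent \<open>1 / (1 - z w)\<close>, so that no complexification is needed over the reals.
\<close>

definition resolvent_denom :: "'a::real_normed_algebra_1 \<Rightarrow> complex \<Rightarrow> 'a"
  where "resolvent_denom w z = 1 - (2 * Re z) *\<^sub>R w + (cmod z)\<^sup>2 *\<^sub>R (w * w)"

definition resolvent_re :: "'a::real_normed_algebra_1 \<Rightarrow> complex \<Rightarrow> 'a"
  where "resolvent_re w z = (1 - Re z *\<^sub>R w) * unit_inverse (resolvent_denom w z)"

lemma unit_inverse_eqI:
  assumes "x * y = 1" "y * x = 1"
  shows "unit_inverse x = y"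
  using unit_inverse[OF two_sided_unitI[OF assms]] assms
  by (metis mult.assoc mult_1_left mult_1_right)

lemma Re_square_cmod: "Re (z * z) = 2 * (Re z)\<^sup>2 - (cmod z)\<^sup>2"
  unfolding cmod_power2 by (simp add: power2_eq_square)

text \<open>With \<open>\<zeta> = z w\<close>, the denominator is \<open>(1 - \<zeta>)\<close> times
  its conjugate, and \<open>(1 - \<zeta>) (1 + \<zeta>) = 1 - \<zeta>\<^sup>2\<close>.\<close>

lemma resolvent_denom_mult:
  "resolvent_denom w z * resolvent_denom w (- z) = resolvent_denom (w * w) (z * z)"
  "resolvent_denom w (- z) * resolvent_denom w z = resolvent_denom (w * w) (z * z)"
proof -
  define a r where "a = Re z" and "r = (cmod z)\<^sup>2"
  define u v where "u = (2 * a) *\<^sub>R w" and "v = r *\<^sub>R (w * w)"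
  have uv: "u * v = v * u" by (simp add: u_def v_def mult_ac)
  have d: "resolvent_denom w z = 1 - u + v" "resolvent_denom w (- z) = 1 + u + v"
    by (simp_all add: resolvent_denom_def u_def v_def a_def r_def)
  have "resolvent_denom (w * w) (z * z)
      = 1 - (2 * (2 * a\<^sup>2 - r)) *\<^sub>R (w * w) + r\<^sup>2 *\<^sub>R (w * w * (w * w))"
    unfolding resolvent_denom_def Re_square_cmod
    by (simp add: a_def r_def norm_mult power2_eq_square)
  also have "\<dots> = 1 + v + v + v * v - u * u"
  proof -
    have "(2 * (2 * a\<^sup>2 - r)) *\<^sub>R (w * w) = u * u - v - v"
      by (simp add: u_def v_def power2_eq_square flip: scaleR_diff_left)
    moreover have "r\<^sup>2 *\<^sub>R (w * w * (w * w)) = v * v" by (simp add: v_def power2_eq_square)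
    ultimately show ?thesis by simp
  qed
  finally show "resolvent_denom w z * resolvent_denom w (- z) = resolvent_denom (w * w) (z * z)"
    "resolvent_denom w (- z) * resolvent_denom w z = resolvent_denom (w * w) (z * z)"
    by (simp_all add: d algebra_simps uv)
qed

text \<open>The identity \<open>2 / (1 - \<zeta>\<^sup>2) = 1 / (1 - \<zeta>) + 1 / (1 + \<zeta>)\<close> for \<open>\<zeta> = z w\<close>.\<close>

lemma resolvent_re_square:
  assumes "two_sided_unit (resolvent_denom w z)" "two_sided_unit (resolvent_denom w (- z))"
  shows "2 *\<^sub>R resolvent_re (w * w) (z * z) = resolvent_re w z + resolvent_re w (- z)"
proof -
  define p q P R where "p = resolvent_denom w z" and "q = resolvent_denom w (- z)"
    and "P = unit_inverse p" and "R = unit_inverse q"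
  have P: "p * P = 1" "P * p = 1" and R: "q * R = 1" "R * q = 1"
    using unit_inverse assms by (auto simp: p_def q_def P_def R_def)
  have P': "p * (P * x) = x" "P * (p * x) = x" and R': "q * (R * x) = x" "R * (q * x) = x" for x
    using P R by (metis mult.assoc mult_1_left)+
  define D where "D = unit_inverse (resolvent_denom (w * w) (z * z))"
  \<comment> \<open>The inverse of the product is written in both orders: one lets \<open>q\<close>
    cancel from the left, the other \<open>p\<close>.\<close>
  have D1: "D = R * P" unfolding D_def resolvent_denom_mult(1)[of w z, symmetric]
    using P R P' R' by (intro unit_inverse_eqI) (simp_all add: mult.assoc flip: p_def q_def)
  have D2: "D = P * R" unfolding D_def resolvent_denom_mult(2)[of w z, symmetric]
    using P R P' R' by (intro unit_inverse_eqI) (simp_all add: mult.assoc flip: p_def q_def)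
  define a r c where "a = Re z" and "r = (cmod z)\<^sup>2" and "c = Re (z * z)"
  have c: "c = 2 * a\<^sup>2 - r" unfolding a_def r_def c_def by (rule Re_square_cmod)
  define u v where "u = a *\<^sub>R w" and "v = r *\<^sub>R (w * w)"
  have uv: "u * v = v * u" by (simp add: u_def v_def mult_ac)
  have pq: "p = 1 - (u + u) + v" "q = 1 + (u + u) + v"
    by (simp_all add: p_def q_def resolvent_denom_def u_def v_def a_def r_def
        flip: scaleR_add_left)
  have "2 *\<^sub>R (1 - c *\<^sub>R (w * w)) = (1 - u) * q + (1 + u) * p"
  proof -
    have cw: "c *\<^sub>R (w * w) = u * u + u * u - v"
      by (simp add: c u_def v_def power2_eq_square flip: scaleR_diff_left scaleR_add_left)
    show ?thesis unfolding scaleR_2 cw pq by (simp add: algebra_simps uv)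
  qed
  then have "2 *\<^sub>R resolvent_re (w * w) (z * z) = ((1 - u) * q + (1 + u) * p) * D"
    by (simp add: resolvent_re_def D_def c_def flip: mult_scaleR_left)
  also have "\<dots> = (1 - u) * (q * D) + (1 + u) * (p * D)" by (simp add: distrib_right mult.assoc)
  also have "q * D = P" using R' by (simp add: D1)
  also have "p * D = R" using P' by (simp add: D2)
  also have "(1 - u) * P + (1 + u) * R = resolvent_re w z + resolvent_re w (- z)"
    by (simp add: resolvent_re_def u_def a_def P_def R_def p_def q_def)
  finally show ?thesis .
qed

text \<open>Each point of the disc of radius \<open>R\<^sup>2\<close> is the square of a point of
  the disc of radius \<open>R\<close>.\<close>

lemma resolvent_denom_square_unit:
  assumes "\<And>z. cmod z \<le> R \<Longrightarrow> two_sided_unit (resolvent_denom w z)" "0 \<le> R" "cmod z \<le> R\<^sup>2"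
  shows "two_sided_unit (resolvent_denom (w * w) z)"
proof -
  have "cmod (csqrt z) \<le> R" using assms by (simp add: real_le_lsqrt norm_csqrt)
  then have "two_sided_unit (resolvent_denom (w * w) (csqrt z * csqrt z))"
    unfolding resolvent_denom_mult(1)[symmetric] by (intro two_sided_unit_mult assms) auto
  then show ?thesis by (simp flip: power2_eq_square)
qed

lemma resolvent_denom_power_unit:
  assumes "\<And>z. cmod z \<le> R \<Longrightarrow> two_sided_unit (resolvent_denom w z)" "0 \<le> R" "cmod z \<le> R ^ 2 ^ n"
  shows "two_sided_unit (resolvent_denom (w ^ 2 ^ n) z)"
  using assms
proof (induction n arbitrary: w R)
  case (Suc n)
  have "two_sided_unit (resolvent_denom ((w * w) ^ 2 ^ n) z)"
    using Suc.prems resolvent_denom_square_unit[OF Suc.prems(1,2)]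
    by (intro Suc.IH[of "R\<^sup>2"]) (auto simp: power_mult)
  then show ?case by (simp add: power_mult power2_eq_square)
qed simp

text \<open>The resolvent of \<open>w * w\<close> at a square is the mean of two values of the
  resolvent of \<open>w\<close>, so a bound on differences survives squaring with the same
  \<open>\<epsilon>\<close>. It is assumed on the whole unit circle because each squaring passes to
  a square root of \<open>e\<close>.\<close>

lemma resolvent_re_power_diff:
  fixes w :: "'a::real_normed_algebra_1"
  assumes "\<And>z. cmod z \<le> R \<Longrightarrow> two_sided_unit (resolvent_denom w z)"
    and "0 \<le> r" "r \<le> R" "0 \<le> s" "s \<le> R"
    and "\<And>e. cmod e = 1 \<Longrightarrow> norm (resolvent_re w (of_real r * e) - resolvent_re w (of_real s * e)) \<le> \<epsilon>"
    and "cmod e = 1"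
  shows "norm (resolvent_re (w ^ 2 ^ n) (of_real (r ^ 2 ^ n) * e)
    - resolvent_re (w ^ 2 ^ n) (of_real (s ^ 2 ^ n) * e)) \<le> \<epsilon>"
  using assms
proof (induction n arbitrary: w R r s e)
  case (Suc n)
  have R: "R \<ge> 0" using Suc.prems by simp
  have "norm (resolvent_re ((w * w) ^ 2 ^ n) (of_real ((r\<^sup>2) ^ 2 ^ n) * e)
    - resolvent_re ((w * w) ^ 2 ^ n) (of_real ((s\<^sup>2) ^ 2 ^ n) * e)) \<le> \<epsilon>"
  proof (rule Suc.IH[where R = "R\<^sup>2"])
    show "two_sided_unit (resolvent_denom (w * w) z)" if "cmod z \<le> R\<^sup>2" for z
      using Suc.prems(1) R that by (rule resolvent_denom_square_unit)
  next
    fix e :: complex assume e: "cmod e = 1"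
    define c where "c = csqrt e"
    have c: "cmod c = 1" "c * c = e" using e by (simp_all add: c_def norm_csqrt flip: power2_eq_square)
    have dbl: "2 *\<^sub>R resolvent_re (w * w) (of_real (t\<^sup>2) * e)
        = resolvent_re w (of_real t * c) + resolvent_re w (of_real t * - c)"
      if "0 \<le> t" "t \<le> R" for t
    proof -
      have "cmod (of_real t * c) \<le> R" using that c by (simp add: norm_mult)
      then show ?thesis
        using resolvent_re_square[of w "of_real t * c"] Suc.prems(1)
        by (simp add: c(2)[symmetric] power2_eq_square mult_ac)
    qed
    have "2 *\<^sub>R (resolvent_re (w * w) (of_real (r\<^sup>2) * e) - resolvent_re (w * w) (of_real (s\<^sup>2) * e))
        = (resolvent_re w (of_real r * c) - resolvent_re w (of_real s * c))
        + (resolvent_re w (of_real r * - c) - resolvent_re w (of_real s * - c))"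
      using dbl[of r] dbl[of s] Suc.prems by (simp add: scaleR_diff_right)
    also have "norm \<dots> \<le> \<epsilon> + \<epsilon>"
      using c(1) by (intro norm_triangle_le add_mono Suc.prems) auto
    finally show "norm (resolvent_re (w * w) (of_real (r\<^sup>2) * e)
        - resolvent_re (w * w) (of_real (s\<^sup>2) * e)) \<le> \<epsilon>" by simp
  qed (use Suc.prems in \<open>auto intro: power_mono\<close>)
  then show ?case by (simp add: power_mult flip: power2_eq_square)
qed simp

lemma resolvent_denom_unit:
  fixes w :: "'a::hermitian_cstar_algebra"
  assumes w: "adj w = w" and real: "Im z = 0 \<Longrightarrow> two_sided_unit (1 - Re z *\<^sub>R w)"
  shows "two_sided_unit (resolvent_denom w z)"
proof (cases "Im z = 0")
  case True
  have "resolvent_denom w z = (1 - Re z *\<^sub>R w) * (1 - Re z *\<^sub>R w)"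
    unfolding resolvent_denom_def cmod_power2
    using True by (simp add: algebra_simps power2_eq_square flip: scaleR_add_left)
  with real[OF True] show ?thesis by (simp add: two_sided_unit_mult)
next
  case False
  define a b r where "a = Re z" and "b = Im z" and "r = (cmod z)\<^sup>2"
  have r: "r = a\<^sup>2 + b\<^sup>2" by (simp add: a_def b_def r_def cmod_power2)
  have b: "b \<noteq> 0" using False by (simp add: b_def)
  have r0: "r > 0" using b by (simp add: r sum_power2_gt_zero_iff)
  \<comment> \<open>Completing the square in \<open>1 - 2 a w + r w\<^sup>2\<close>, with
    \<open>r - a\<^sup>2 = b\<^sup>2\<close>, leaves a positive multiple of
    \<open>1 + h * h\<close>.\<close>
  define h where "h = (r / b) *\<^sub>R w - (a / b) *\<^sub>R 1"
  have "adj h = h" by (simp add: h_def adj_simps w)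
  then have "two_sided_unit (1 + h * h)" by (rule one_plus_square_unit)
  moreover have "resolvent_denom w z = (b\<^sup>2 / r) *\<^sub>R (1 + h * h)"
  proof -
    have "(2 * a * r / b\<^sup>2) *\<^sub>R w = (a * r / b\<^sup>2) *\<^sub>R w + (a * r / b\<^sup>2) *\<^sub>R w"
      by (simp flip: scaleR_add_left)
    then have hh: "1 + h * h
        = (1 + a\<^sup>2 / b\<^sup>2) *\<^sub>R 1 - (2 * a * r / b\<^sup>2) *\<^sub>R w + (r\<^sup>2 / b\<^sup>2) *\<^sub>R (w * w)"
      by (simp add: h_def algebra_simps power2_eq_square)
    have "b\<^sup>2 * (1 + a\<^sup>2 / b\<^sup>2) = r" using b by (simp add: r distrib_left)
    then have c1: "b\<^sup>2 / r * (1 + a\<^sup>2 / b\<^sup>2) = 1" using r0 by simp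
    have c2: "b\<^sup>2 / r * (2 * a * r / b\<^sup>2) = 2 * a" using b r0 by simp
    have c3: "b\<^sup>2 / r * (r\<^sup>2 / b\<^sup>2) = r" using b r0 by (simp add: power2_eq_square)
    show ?thesis
      unfolding hh scaleR_add_right scaleR_diff_right scaleR_scaleR c1 c2 c3
      by (simp add: resolvent_denom_def flip: a_def r_def)
  qed
  ultimately show ?thesis using b r0 by (simp add: two_sided_unit_scaleR_iff)
qed

lemma continuous_on_resolvent_re:
  assumes "\<And>z. z \<in> S \<Longrightarrow> two_sided_unit (resolvent_denom w z)"
  shows "continuous_on S (resolvent_re w)"
proof -
  have "continuous_on S (resolvent_denom w)"
    unfolding resolvent_denom_def by (intro continuous_intros)
  then have "continuous_on S (\<lambda>z. unit_inverse (resolvent_denom w z))"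
    using assms by (rule continuous_on_unit_inverse)
  then show ?thesis unfolding resolvent_re_def by (intro continuous_intros)
qed

lemma resolvent_re_of_real:
  assumes "two_sided_unit (resolvent_denom w (of_real t))"
  shows "(1 - t *\<^sub>R w) * resolvent_re w (of_real t) = 1"
proof -
  have "resolvent_denom w (of_real t) = (1 - t *\<^sub>R w) * (1 - t *\<^sub>R w)"
    by (simp add: resolvent_denom_def algebra_simps power2_eq_square flip: scaleR_add_left)
  with unit_inverse(1)[OF assms] show ?thesis by (simp add: resolvent_re_def mult.assoc)
qed

text \<open>
  The spectral radius formula for self-adjoint elements.  Were both \<open>1 - w\<close> and \<open>1 + w\<close>
  invertible, the resolvent would be uniformly continuous on a disc of radius greater than one, and
  averaging over roots of unity would give \<open>(1 - r\<^sup>N w\<^sup>N)\<inverse> \<approx> (1 - s\<^sup>N w\<^sup>N)\<inverse>\<close> with \<open>r < 1 < s\<close>,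
  uniformly in \<open>N = 2\<^sup>n\<close>; but \<open>\<parallel>w\<^sup>N\<parallel> = 1\<close>.
\<close>

lemma spectral_radius_self_adjoint_aux:
  fixes w :: "'a::hermitian_cstar_algebra"
  assumes w: "adj w = w" "norm w = 1"
    and minus: "two_sided_unit (1 - w)" and plus: "two_sided_unit (1 + w)"
  shows False
proof -
  obtain \<delta>1 where \<delta>1: "\<delta>1 > 0" "\<And>d. norm d < \<delta>1 \<Longrightarrow> two_sided_unit (1 - w + d)"
    using two_sided_unit_near[OF minus] by blast
  obtain \<delta>2 where \<delta>2: "\<delta>2 > 0" "\<And>d. norm d < \<delta>2 \<Longrightarrow> two_sided_unit (1 + w + d)"
    using two_sided_unit_near[OF plus] by blast
  \<comment> \<open>A real \<open>x\<close> with \<open>\<bar>x\<bar> \<le> R\<close> lies in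
    \<open>(-1, 1)\<close> or strictly within \<open>\<delta>1\<close> of \<open>1\<close> or
    \<open>\<delta>2\<close> of \<open>-1\<close>.\<close>
  define R where "R = 1 + min \<delta>1 \<delta>2 / 2"
  have real: "two_sided_unit (1 - x *\<^sub>R w)" if "\<bar>x\<bar> \<le> R" for x
  proof -
    consider "\<bar>x\<bar> < 1" | "x \<ge> 1" | "x \<le> - 1" by linarith
    then show ?thesis
    proof cases
      case 1
      then show ?thesis using w by (intro two_sided_unit_one_minus) simp
    next
      case 2
      have "1 - x *\<^sub>R w = 1 - w + (1 - x) *\<^sub>R w" by (simp add: algebra_simps)
      moreover have "norm ((1 - x) *\<^sub>R w) < \<delta>1" using 2 that w \<delta>1(1) \<delta>2(1) by (simp add: R_def)
      ultimately show ?thesis using \<delta>1(2) by metis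
    next
      case 3
      have "1 - x *\<^sub>R w = 1 + w + (- 1 - x) *\<^sub>R w" by (simp add: algebra_simps)
      moreover have "norm ((- 1 - x) *\<^sub>R w) < \<delta>2" using 3 that w \<delta>1(1) \<delta>2(1) by (simp add: R_def)
      ultimately show ?thesis using \<delta>2(2) by metis
    qed
  qed
  have unit: "two_sided_unit (resolvent_denom w z)" if "cmod z \<le> R" for z
    using w(1) by (rule resolvent_denom_unit) (use real that abs_Re_le_cmod[of z] in auto)
  have "uniformly_continuous_on (cball 0 R) (resolvent_re w)"
    by (intro compact_uniformly_continuous continuous_on_resolvent_re unit) auto
  then obtain d where d: "d > 0" "\<And>z z'. cmod z \<le> R \<Longrightarrow> cmod z' \<le> R \<Longrightarrow> cmod (z' - z) < d \<Longrightarrow>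
      norm (resolvent_re w z' - resolvent_re w z) < 1 / 4"
    unfolding uniformly_continuous_on_def by (auto simp: dist_norm dest: spec[of _ "1 / 4"])
  \<comment> \<open>The three bounds keep \<open>1 + \<eta>\<close> within \<open>R\<close>, the two
    radii \<open>1 - \<eta>\<close> and \<open>1 + \<eta>\<close> less than \<open>d\<close> apart,
    and \<open>1 - \<eta>\<close> positive.\<close>
  define \<eta> where "\<eta> = min (min (min \<delta>1 \<delta>2 / 2) (d / 3)) (1 / 2)"
  have \<eta>: "\<eta> > 0" "\<eta> \<le> 1 / 2" "1 + \<eta> \<le> R" "2 * \<eta> < d"
    using \<delta>1(1) \<delta>2(1) d(1) by (auto simp: \<eta>_def R_def)
  define r s where "r = 1 - \<eta>" and "s = 1 + \<eta>"
  have rs: "0 < r" "r < 1" "1 < s" "s \<le> R" using \<eta> by (auto simp: r_def s_def)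
  obtain n where n: "r ^ n < 1 / 5" using real_arch_pow_inv[of "1 / 5" r] rs by auto
  define N :: nat where "N = 2 ^ n"
  have N: "N \<ge> n" "N > 0" by (auto simp: N_def intro: less_imp_le)
  define X Y where "X = (\<lambda>t. (t ^ N) *\<^sub>R w ^ N)" and "Y = (\<lambda>t. resolvent_re (w ^ N) (of_real (t ^ N)))"
  have normX: "norm (X t) = t ^ N" if "t \<ge> 0" for t
    using that w norm_self_adjoint_power[of w n] by (simp add: X_def N_def)
  have XY: "(1 - X t) * Y t = 1" if "t \<ge> 0" "t \<le> R" for t
    unfolding X_def Y_def N_def using rs that
    by (intro resolvent_re_of_real resolvent_denom_power_unit[OF unit]) (auto simp: norm_power intro: power_mono)
  have "norm (Y r - Y s) \<le> 1 / 4"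
  proof -
    have "norm (resolvent_re w (of_real r * e) - resolvent_re w (of_real s * e)) \<le> 1 / 4"
      if "cmod e = 1" for e
    proof (rule less_imp_le, rule d(2))
      have "of_real r * e - of_real s * e = of_real (- 2 * \<eta>) * e"
        by (simp add: r_def s_def algebra_simps)
      then show "cmod (of_real r * e - of_real s * e) < d"
        using \<eta> that by (simp add: norm_mult)
    qed (use rs that in \<open>auto simp: norm_mult\<close>)
    then show ?thesis
      using resolvent_re_power_diff[of R w r s "1 / 4" 1 n] unit rs by (simp add: Y_def N_def)
  qed
  \<comment> \<open>Since \<open>Y r - 1 = X r * Y r\<close>, the bound \<open>1 / 5\<close> on
    \<open>X r\<close> gives \<open>norm (Y r - 1) \<le> (1 + norm (Y r - 1)) / 5\<close>.\<close>
  moreover have "norm (Y r - 1) \<le> 1 / 4"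
  proof -
    have "r ^ N \<le> r ^ n" using N rs by (intro power_decreasing) auto
    moreover have "norm (X r) = r ^ N" using normX[of r] rs by simp
    ultimately have x: "norm (X r) \<le> 1 / 5" using n by linarith
    have y: "Y r - 1 = X r * Y r" using XY[of r] rs by (simp add: algebra_simps)
    have "norm (X r * Y r) \<le> 1 / 5 * norm (Y r)"
      using norm_mult_ineq[of "X r" "Y r"] mult_right_mono[OF x, of "norm (Y r)"] by simp
    with y norm_triangle_sub[of "Y r" 1] show ?thesis by simp
  qed
  ultimately have y: "norm (Y s - 1) \<le> 1 / 2"
    using norm_triangle_ineq[of "Y s - Y r" "Y r - 1"] by (simp add: norm_minus_commute)
  \<comment> \<open>Solving for \<open>X s\<close> turns closeness of \<open>Y s\<close> to
    \<open>1\<close> into \<open>norm (X s) \<le> 1\<close>, against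
    \<open>norm (X s) = s ^ N > 1\<close>.\<close>
  have "X s = (Y s - 1) - X s * (Y s - 1)" using XY[of s] rs by (simp add: algebra_simps)
  then have "norm (X s) \<le> norm (Y s - 1) + norm (X s) * norm (Y s - 1)"
    by (metis norm_triangle_le_diff add_left_mono norm_mult_ineq order_refl add_mono)
  also have "\<dots> \<le> 1 / 2 + norm (X s) * (1 / 2)" using y by (intro add_mono mult_left_mono) auto
  finally have "norm (X s) \<le> 1" by simp
  moreover have "norm (X s) > 1" using normX[of s] rs N one_less_power[of s N] by simp
  ultimately show False by simp
qed

lemma norm_in_spectrum_self_adjoint:
  fixes h :: "'a::hermitian_cstar_algebra"
  assumes h: "adj h = h" and "two_sided_unit (of_real (norm h) + h)"
  shows "\<not> two_sided_unit (of_real (norm h) - h)"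
proof (cases "h = 0")
  case True
  then show ?thesis by (simp add: two_sided_unit_def)
next
  case False
  define w where "w = inverse (norm h) *\<^sub>R h"
  have "adj w = w" "norm w = 1" using h False by (simp_all add: w_def adj_scaleR)
  then have "\<not> (two_sided_unit (1 - w) \<and> two_sided_unit (1 + w))"
    using spectral_radius_self_adjoint_aux by blast
  moreover have "of_real (norm h) + h = norm h *\<^sub>R (1 + w)" "of_real (norm h) - h = norm h *\<^sub>R (1 - w)"
    using False by (simp_all add: w_def algebra_simps of_real_def)
  ultimately show ?thesis using assms(2) False by (simp add: two_sided_unit_scaleR_iff)
qed

section \<open>Positive elements and functionals\<close>

lemma two_sided_unit_of_real_plus_square:
  fixes h :: "'a::hermitian_cstar_algebra"
  assumes "adj h = h" "t > 0"
  shows "two_sided_unit (of_real t + h * h)"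
proof -
  have "two_sided_unit (1 + (inverse (sqrt t) *\<^sub>R h) * (inverse (sqrt t) *\<^sub>R h))"
    using assms(1) by (intro one_plus_square_unit) (simp add: adj_scaleR)
  moreover have "of_real t + h * h
      = t *\<^sub>R (1 + (inverse (sqrt t) *\<^sub>R h) * (inverse (sqrt t) *\<^sub>R h))"
  proof -
    have "t * (inverse (sqrt t) * inverse (sqrt t)) = 1"
      using assms(2) by (simp flip: inverse_mult_distrib)
    then show ?thesis by (simp add: scaleR_add_right of_real_def)
  qed
  ultimately show ?thesis using assms(2) by (simp add: two_sided_unit_scaleR_iff)
qed

text \<open>Only negative reals are excluded from the spectrum. As self-adjoint elements have real
  spectrum, this matches both notions of positivity and needs no complex scalars.\<close>

definition hermitian_positive :: "'a::hermitian_cstar_algebra \<Rightarrow> bool"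
  where "hermitian_positive x \<longleftrightarrow> adj x = x \<and> (\<forall>t>0. two_sided_unit (of_real t + x))"

lemma hermitian_positiveI_norm:
  assumes "adj y = y" "norm (of_real c - y) \<le> c"
  shows "hermitian_positive y"
  unfolding hermitian_positive_def
proof (intro conjI allI impI)
  fix t :: real assume "t > 0"
  then have "two_sided_unit (of_real (t + c) - (of_real c - y))"
    using assms(2) norm_ge_zero[of "of_real c - y"]
    by (intro two_sided_unit_of_real_minus) simp
  then show "two_sided_unit (of_real t + y)" by simp
qed fact

text \<open>Were the norm of \<open>h = norm y - y\<close> larger than \<open>norm y\<close>, then
  \<open>norm h + h\<close> would be invertible by the norm bound and \<open>norm h - h\<close> by
  positivity, so \<open>h\<close> would not attain its norm in its spectrum.\<close>

lemma hermitian_positive_norm_le: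
  assumes "hermitian_positive y"
  shows "norm (of_real (norm y) - y) \<le> norm y"
proof (rule ccontr)
  define h where "h = of_real (norm y) - y"
  assume "\<not> norm (of_real (norm y) - y) \<le> norm y"
  then have less: "norm h > norm y" by (simp add: h_def)
  have "two_sided_unit (of_real (norm h + norm y) - y)"
    using less norm_ge_zero[of y] by (intro two_sided_unit_of_real_minus) linarith
  then have "two_sided_unit (of_real (norm h) + h)" by (simp add: h_def add_diff_eq)
  moreover have "two_sided_unit (of_real (norm h - norm y) + y)"
    using assms less unfolding hermitian_positive_def by (simp del: of_real_diff)
  then have "two_sided_unit (of_real (norm h) - h)" by (simp add: h_def algebra_simps)
  moreover have "adj h = h" using assms by (simp add: h_def adj_diff hermitian_positive_def)
  ultimately show False using norm_in_spectrum_self_adjoint by blast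
qed

text \<open>Positivity has been turned into a norm inequality, which the triangle inequality adds
  up.\<close>

lemma hermitian_positive_add:
  assumes "hermitian_positive x" "hermitian_positive y"
  shows "hermitian_positive (x + y)"
proof (rule hermitian_positiveI_norm)
  show "adj (x + y) = x + y" using assms by (simp add: adj_add hermitian_positive_def)
  have "norm (of_real (norm x + norm y) - (x + y))
      \<le> norm (of_real (norm x) - x) + norm (of_real (norm y) - y)"
    using norm_triangle_ineq[of "of_real (norm x) - x" "of_real (norm y) - y"]
    by (simp add: algebra_simps)
  also have "\<dots> \<le> norm x + norm y"
    using assms by (intro add_mono hermitian_positive_norm_le)
  finally show "norm (of_real (norm x + norm y) - (x + y)) \<le> norm x + norm y" .
qed

lemma hermitian_positive_square: "adj h = h \<Longrightarrow> hermitian_positive (h * h)"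
  by (simp add: hermitian_positive_def adj_mult two_sided_unit_of_real_plus_square)

lemma hermitian_positive_norm_minus:
  "adj h = h \<Longrightarrow> hermitian_positive (of_real (norm h) - h)"
  by (rule hermitian_positiveI_norm[where c = "norm h"]) (simp_all add: adj_diff)

section \<open>Norm-bounded unital functionals and states\<close>

lemma functional_positive:
  assumes f: "linear f" "\<And>x. f x \<le> norm x" "f 1 = 1" and y: "hermitian_positive y"
  shows "f y \<ge> 0"
proof -
  have "f (of_real (norm y) - y) = norm y - f y"
    using f(1,3) by (simp add: linear_diff linear_scale of_real_def)
  then show ?thesis using f(2)[of "of_real (norm y) - y"] hermitian_positive_norm_le[OF y] by linarith
qed

text \<open>For skew \<open>k\<close>, \<open>norm (t + k)\<close> squared grows only like
  \<open>t\<^sup>2 + norm k ^ 2\<close>, while \<open>(t + f k)\<^sup>2\<close> has a term linear in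
  \<open>t\<close>.\<close>

lemma functional_skew_adjoint:
  fixes f :: "'a::cstar_normed_algebra \<Rightarrow> real"
  assumes f: "linear f" "\<And>x. f x \<le> norm x" "f 1 = 1" and k: "adj k = - k"
  shows "f k = 0"
proof -
  have le: "f k \<le> 0" if k: "adj k = - k" for k
  proof (rule ccontr)
    assume "\<not> f k \<le> 0"
    then have pos: "f k > 0" by simp
    \<comment> \<open>The cross term \<open>2 * t * f k\<close> then absorbs the square of
      \<open>norm k\<close> exactly, leaving \<open>(f k)\<^sup>2 \<le> 0\<close>.\<close>
    define t where "t = (norm k)\<^sup>2 / (2 * f k)"
    have t: "t \<ge> 0" "2 * t * f k = (norm k)\<^sup>2" using pos by (simp_all add: t_def)
    have "t + f k = f (of_real t + k)" using f(1,3) by (simp add: linear_add linear_scale of_real_def)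
    then have "(t + f k)\<^sup>2 \<le> (norm (of_real t + k))\<^sup>2"
      using t pos f(2) by (intro power_mono) auto
    also have "\<dots> = norm (adj (of_real t + k) * (of_real t + k))" by (simp add: cstar_identity)
    also have "adj (of_real t + k) * (of_real t + k) = of_real (t\<^sup>2) - k * k"
      using k by (simp add: adj_add adj_scaleR algebra_simps power2_eq_square of_real_def)
    also have "norm \<dots> \<le> norm (of_real (t\<^sup>2) :: 'a) + norm (k * k)" by (rule norm_triangle_ineq4)
    also have "\<dots> \<le> t\<^sup>2 + (norm k)\<^sup>2"
      unfolding norm_of_real using norm_mult_ineq[of k k] by (simp add: power2_eq_square)
    finally have "(f k)\<^sup>2 \<le> 0" using t(2) by (simp add: power2_sum)
    with pos show False by simp
  qed
  from le[OF k] le[of "- k"] show ?thesis using k f(1) by (simp add: linear_neg adj_minus)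
qed

lemma functional_adj:
  fixes f :: "'a::cstar_normed_algebra \<Rightarrow> real"
  assumes "linear f" "\<And>x. f x \<le> norm x" "f 1 = 1"
  shows "f (adj x) = f x"
  using functional_skew_adjoint[OF assms, of "adj x - x"] assms(1)
  by (simp add: adj_simps linear_diff)

text \<open>Invariance under \<open>adj\<close> replaces \<open>x\<close> by its self-adjoint part
  \<open>h\<close>, and \<open>norm h - h\<close> is positive.\<close>

lemma positive_functional_le_norm:
  assumes f: "linear f" "f 1 = 1" and adj: "\<And>x. f (adj x) = f x"
    and pos: "\<And>y. hermitian_positive y \<Longrightarrow> f y \<ge> 0"
  shows "f x \<le> norm x"
proof -
  define h where "h = (1 / 2) *\<^sub>R (x + adj x)"
  have h: "adj h = h" by (simp add: h_def adj_simps add.commute)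
  have "f x = f h" using f(1) adj[of x] by (simp add: h_def linear_add linear_scale)
  also have "\<dots> \<le> norm h"
    using pos[OF hermitian_positive_norm_minus[OF h]] f by (simp add: linear_diff linear_scale of_real_def)
  also have "\<dots> \<le> norm x" using norm_triangle_ineq[of x "adj x"] by (simp add: h_def)
  finally show ?thesis .
qed

text \<open>
  Orthogonality gives \<open>\<parallel>1 + (a + \<epsilon>b)\<^sup>*(a + \<epsilon>b)\<parallel> \<ge> \<parallel>1 + a\<^sup>*a\<parallel>\<close>.  Up to \<open>O(\<epsilon>\<^sup>2)\<close> the left side is a
  convex function of \<open>\<epsilon>\<close>, so its first-order growth at \<open>0\<close> is nonnegative and persists to \<open>\<epsilon> = 1\<close>.
\<close>

lemma birkhoff_james_one_plus:
  fixes a :: "'a::cstar_normed_algebra"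
  assumes N: "\<And>x::'a. 1 + (norm x)\<^sup>2 \<le> norm (1 + adj x * x)"
    and B: "subspace B" and orth: "birkhoff_james_orthogonal a B" and b: "b \<in> B"
  shows "norm (1 + adj a * a) \<le> norm (1 + adj a * a + adj a * b)"
proof -
  define p where "p = 1 + adj a * a"
  \<comment> \<open>The half makes \<open>c\<close> the self-adjoint part of
    \<open>adj a * b\<close>.\<close>
  define d where "d = (1 / 2) *\<^sub>R b"
  define c where "c = adj a * d + adj d * a"
  have p: "norm p \<le> 1 + (norm a)\<^sup>2"
    using norm_triangle_ineq[of 1 "adj a * a"] by (simp add: p_def cstar_identity)
  have "norm p \<le> norm (p + c)"
  proof (rule field_le_epsilon)
    fix e :: real assume e: "e > 0"
    \<comment> \<open>\<open>t \<le> 1\<close> allows a convex combination, and the quadratic error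
      divided by \<open>t\<close> is at most \<open>e\<close>.\<close>
    define t where "t = min 1 (e / (1 + (norm d)\<^sup>2))"
    have t: "0 < t" "t \<le> 1" using e by (auto simp: t_def add_pos_nonneg)
    have "t * (norm d)\<^sup>2 \<le> e / (1 + (norm d)\<^sup>2) * (1 + (norm d)\<^sup>2)"
      using t by (intro mult_mono) (auto simp: t_def)
    then have td: "t * (norm d)\<^sup>2 \<le> e" by (simp add: add_nonneg_eq_0_iff)
    define x where "x = a + t *\<^sub>R d"
    have "t *\<^sub>R d \<in> B" using B b by (simp add: d_def subspace_scale)
    then have "norm a \<le> norm x" using orth by (auto simp: birkhoff_james_orthogonal_def x_def)
    then have "(norm a)\<^sup>2 \<le> (norm x)\<^sup>2" by (intro power_mono) auto
    with p have "norm p \<le> 1 + (norm x)\<^sup>2" by linarith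
    also have "\<dots> \<le> norm (1 + adj x * x)" by (rule N)
    also have "1 + adj x * x = (1 - t) *\<^sub>R p + t *\<^sub>R (p + c) + (t * t) *\<^sub>R (adj d * d)"
      by (simp add: x_def p_def c_def adj_simps algebra_simps)
    also have "norm \<dots> \<le> (1 - t) * norm p + t * norm (p + c) + t * t * (norm d)\<^sup>2"
      using t by (intro norm_triangle_le add_mono) (auto simp: cstar_identity)
    finally have "t * norm p \<le> t * (norm (p + c) + t * (norm d)\<^sup>2)" by (simp add: algebra_simps)
    then have "norm p \<le> norm (p + c) + t * (norm d)\<^sup>2" using t by simp
    with td show "norm p \<le> norm (p + c) + e" by simp
  qed
  \<comment> \<open>Passing to the self-adjoint part does not increase the norm.\<close>
  also have "p + c = (1 / 2) *\<^sub>R ((p + adj a * b) + adj (p + adj a * b))"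
  proof -
    have "p = (1 / 2) *\<^sub>R (p + adj p)" by (simp add: p_def adj_simps flip: scaleR_2)
    moreover have "c = (1 / 2) *\<^sub>R (adj a * b + adj (adj a * b))"
      by (simp add: c_def d_def adj_simps scaleR_add_right)
    ultimately have "p + c = (1 / 2) *\<^sub>R (p + adj p) + (1 / 2) *\<^sub>R (adj a * b + adj (adj a * b))"
      by (rule arg_cong2)
    then show ?thesis by (simp only: adj_add scaleR_add_right ac_simps)
  qed
  also have "norm \<dots> \<le> norm (p + adj a * b)"
    using norm_triangle_ineq[of "p + adj a * b" "adj (p + adj a * b)"] by simp
  finally show ?thesis by (simp add: p_def)
qed

lemma birkhoff_james_functional:
  fixes a :: "'a::cstar_normed_algebra"
  assumes N: "\<And>x::'a. 1 + (norm x)\<^sup>2 \<le> norm (1 + adj x * x)"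
    and B: "subspace B" and orth: "birkhoff_james_orthogonal a B"
  obtains f where "linear f" "\<And>x. f x \<le> norm x" "f 1 = 1" "f (adj a * a) = (norm a)\<^sup>2"
    "\<And>b. b \<in> B \<Longrightarrow> f (adj a * b) = 0"
proof -
  have "linear (\<lambda>b. adj a * b)" by (intro linearI) (simp_all add: algebra_simps)
  then have "subspace ((\<lambda>b. adj a * b) ` B)" using B by (rule linear_subspace_image)
  moreover have "norm (1 + adj a * a) \<le> norm (1 + adj a * a + w)" if "w \<in> (\<lambda>b. adj a * b) ` B" for w
    using that birkhoff_james_one_plus[OF N B orth] by blast
  ultimately obtain f where f: "linear f" "\<And>x. f x \<le> norm x"
    "f (1 + adj a * a) = norm (1 + adj a * a)" "\<And>w. w \<in> (\<lambda>b. adj a * b) ` B \<Longrightarrow> f w = 0"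
    using norming_functional_annihilating_subspace by blast
  \<comment> \<open>Each value is bounded by its target and the sum reaches the sum of the targets,
    so both are attained.\<close>
  have "f 1 \<le> 1" "f (adj a * a) \<le> (norm a)\<^sup>2" using f(2)[of 1] f(2)[of "adj a * a"] by (simp_all add: cstar_identity)
  moreover have "f 1 + f (adj a * a) \<ge> 1 + (norm a)\<^sup>2" using f(1,3) N[of a] by (simp add: linear_add)
  ultimately have "f 1 = 1" "f (adj a * a) = (norm a)\<^sup>2" by linarith+
  with that f show thesis by blast
qed

lemma birkhoff_james_if_functional:
  fixes a :: "'a::cstar_normed_algebra"
  assumes f: "linear f" "\<And>x. f x \<le> norm x" and a: "f (adj a * a) = (norm a)\<^sup>2"
    and B: "\<And>b. b \<in> B \<Longrightarrow> f (adj a * b) = 0"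
  shows "birkhoff_james_orthogonal a B"
  unfolding birkhoff_james_orthogonal_def
proof
  fix b assume b: "b \<in> B"
  have "(norm a)\<^sup>2 = f (adj a * (a + b))" using f(1) a B[OF b] by (simp add: distrib_left linear_add)
  also have "\<dots> \<le> norm a * norm (a + b)"
    using f(2) norm_mult_ineq[of "adj a" "a + b"] by (metis norm_adj order_trans)
  finally show "norm a \<le> norm (a + b)" by (cases "a = 0") (auto simp: power2_eq_square)
qed

text \<open>A smaller norm would make \<open>1 + (norm x)\<^sup>2\<close> minus
  \<open>1 + adj x * x\<close> invertible, and the two ones cancel.\<close>

lemma one_plus_norm_le:
  fixes x :: "'a::cstar_normed_algebra"
  assumes "\<not> two_sided_unit (of_real ((norm x)\<^sup>2) - adj x * x)"
  shows "1 + (norm x)\<^sup>2 \<le> norm (1 + adj x * x)"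
proof (rule ccontr)
  assume "\<not> 1 + (norm x)\<^sup>2 \<le> norm (1 + adj x * x)"
  then have "two_sided_unit (of_real (1 + (norm x)\<^sup>2) - (1 + adj x * x))"
    by (intro two_sided_unit_of_real_minus) simp
  with assms show False by simp
qed

section \<open>Real algebras\<close>

instance real_cstar_algebra \<subseteq> hermitian_cstar_algebra
proof
  fix h :: 'a assume "adj h = h"
  then show "\<exists>y. (1 + h * h) * y = 1 \<and> y * (1 + h * h) = 1"
    using one_plus_adj_mult_invertible[of h] by simp
qed

text \<open>At a real point the spectral condition concerns the square of \<open>x - Re z\<close>,
  which is invertible exactly when \<open>x - Re z\<close> is; at other points self-adjointness
  alone gives invertibility.\<close>

lemma real_positive_iff: "real_positive x \<longleftrightarrow> hermitian_positive x"
proof -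
  have "two_sided_unit (of_real t + x)" if "real_spectrum x \<subseteq> \<real>\<^sub>\<ge>\<^sub>0" "t > 0" for t
  proof -
    have "complex_of_real (- t) \<notin> real_spectrum x"
      using that by (auto simp: complex_nonneg_Reals_iff)
    then have "two_sided_unit ((x + of_real t) * (x + of_real t))"
      by (simp add: real_spectrum_def power2_eq_square)
    then have "two_sided_unit (x + of_real t)" by (rule two_sided_unit_commuting_factor[OF refl])
    then show ?thesis by (simp add: add.commute)
  qed
  moreover have "z \<in> \<real>\<^sub>\<ge>\<^sub>0" if "hermitian_positive x" "z \<in> real_spectrum x" for z
  proof (rule ccontr)
    assume z: "z \<notin> \<real>\<^sub>\<ge>\<^sub>0"
    define h where "h = x - of_real (Re z)"
    have h: "adj h = h" using that(1) by (simp add: h_def adj_diff hermitian_positive_def)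
    have "two_sided_unit (of_real ((Im z)\<^sup>2) + h * h)"
    proof (cases "Im z = 0")
      case True
      with z have "- Re z > 0" by (simp add: complex_nonneg_Reals_iff)
      then have "two_sided_unit (of_real (- Re z) + x)"
        using that(1) unfolding hermitian_positive_def by blast
      then have "two_sided_unit h" by (simp add: h_def)
      with True show ?thesis by (simp add: two_sided_unit_mult)
    next
      case False
      then have "(Im z)\<^sup>2 > 0" by simp
      with h show ?thesis by (rule two_sided_unit_of_real_plus_square)
    qed
    with that(2) show False
      by (simp add: real_spectrum_def h_def power2_eq_square[of "x - _"] add.commute)
  qed
  ultimately show ?thesis unfolding real_positive_def hermitian_positive_def by blast
qed

text \<open>The class axiom, rescaled, keeps \<open>- (norm x)\<^sup>2\<close> out of the spectrum
  of \<open>adj x * x\<close>, so the norm is attained with the positive sign.\<close>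

lemma real_norm_square_in_spectrum:
  fixes x :: "'a::real_cstar_algebra"
  shows "\<not> two_sided_unit (of_real ((norm x)\<^sup>2) - adj x * x)"
proof (cases "x = 0")
  case True
  then show ?thesis by (simp add: two_sided_unit_def)
next
  case False
  define y where "y = inverse (norm x) *\<^sub>R x"
  have "two_sided_unit (1 + adj y * y)"
    using one_plus_adj_mult_invertible[of y] by (simp add: two_sided_unit_def)
  moreover have "norm x * norm x * (inverse (norm x) * inverse (norm x)) = 1" using False
    by (simp add: field_simps)
  then have "of_real ((norm x)\<^sup>2) + adj x * x = (norm x)\<^sup>2 *\<^sub>R (1 + adj y * y)"
    by (simp add: y_def adj_scaleR scaleR_add_right of_real_def power2_eq_square)
  ultimately have "two_sided_unit (of_real (norm (adj x * x)) + adj x * x)"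
    using False by (simp add: two_sided_unit_scaleR_iff cstar_identity)
  then show ?thesis
    using norm_in_spectrum_self_adjoint[of "adj x * x"] by (simp add: adj_simps cstar_identity)
qed

lemma birkhoff_james_iff_real_state:
  fixes a :: "'a::real_cstar_algebra"
  assumes B: "subspace B"
  shows "birkhoff_james_orthogonal a B \<longleftrightarrow>
    (\<exists>\<phi>. real_state \<phi> \<and> \<phi> (adj a * a) = (norm a)\<^sup>2 \<and> (\<forall>b\<in>B. \<phi> (adj a * b) = 0))"
proof
  assume "birkhoff_james_orthogonal a B"
  then obtain f where f: "linear f" "\<And>x. f x \<le> norm x" "f 1 = 1" "f (adj a * a) = (norm a)\<^sup>2"
    "\<And>b. b \<in> B \<Longrightarrow> f (adj a * b) = 0"
    using birkhoff_james_functional[OF one_plus_norm_le[OF real_norm_square_in_spectrum] B] by blast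
  then have "real_state f"
    using functional_positive[OF f(1-3)] functional_adj[OF f(1-3)]
    by (simp add: real_state_def real_positive_iff)
  with f show "\<exists>\<phi>. real_state \<phi> \<and> \<phi> (adj a * a) = (norm a)\<^sup>2 \<and> (\<forall>b\<in>B. \<phi> (adj a * b) = 0)"
    by blast
next
  assume "\<exists>\<phi>. real_state \<phi> \<and> \<phi> (adj a * a) = (norm a)\<^sup>2 \<and> (\<forall>b\<in>B. \<phi> (adj a * b) = 0)"
  then obtain \<phi> where \<phi>: "linear \<phi>" "\<phi> 1 = 1" "\<And>x. \<phi> (adj x) = \<phi> x"
      "\<And>y. hermitian_positive y \<Longrightarrow> \<phi> y \<ge> 0"
    and a: "\<phi> (adj a * a) = (norm a)\<^sup>2" "\<And>b. b \<in> B \<Longrightarrow> \<phi> (adj a * b) = 0"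
    unfolding real_state_def real_positive_iff by blast
  show "birkhoff_james_orthogonal a B"
    using \<phi>(1) positive_functional_le_norm[OF \<phi>] a by (rule birkhoff_james_if_functional)
qed

section \<open>Complex algebras\<close>

interpretation scaleC: vector_space "scaleC :: complex \<Rightarrow> 'a \<Rightarrow> 'a::complex_cstar_algebra"
  by (rule vector_space_scaleC)

lemma scaleC_scaleR: "c *\<^sub>C r *\<^sub>R x = r *\<^sub>R c *\<^sub>C (x::'a::complex_cstar_algebra)"
  by (metis mult.commute scaleC_of_real scaleC_scaleC)

lemma scaleC_eq_scaleR:
  "z *\<^sub>C x = Re z *\<^sub>R x + Im z *\<^sub>R \<i> *\<^sub>C (x::'a::complex_cstar_algebra)"
proof -
  have "z = complex_of_real (Re z) + complex_of_real (Im z) * \<i>" by (simp add: complex_eq_iff)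
  then show ?thesis by (metis scaleC_add_left scaleC_of_real scaleC_scaleC)
qed

lemma scaleC_imaginary: "(\<i> * complex_of_real r) *\<^sub>C x = r *\<^sub>R \<i> *\<^sub>C (x::'a::complex_cstar_algebra)"
  by (subst scaleC_eq_scaleR) simp

lemma scaleC_of_real_one: "complex_of_real r *\<^sub>C 1 = (of_real r :: 'a::complex_cstar_algebra)"
  by (simp add: scaleC_of_real scaleR_conv_of_real)

lemma two_sided_unit_scaleC:
  fixes x :: "'a::complex_cstar_algebra"
  assumes "two_sided_unit x" "c \<noteq> 0"
  shows "two_sided_unit (c *\<^sub>C x)"
proof -
  obtain y where "x * y = 1" "y * x = 1" using assms(1) unfolding two_sided_unit_def by blast
  with assms(2) show ?thesis
    by (intro two_sided_unitI[of _ "inverse c *\<^sub>C y"])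
      (simp_all add: mult_scaleC_left mult_scaleC_right scaleC_scaleC)
qed

lemma two_sided_unit_scaleC_one_minus:
  fixes x :: "'a::complex_cstar_algebra"
  assumes "norm x < cmod c"
  shows "two_sided_unit (c *\<^sub>C 1 - x)"
proof -
  have c: "c \<noteq> 0" using assms norm_ge_zero[of x] by auto
  have "norm (inverse c *\<^sub>C x) = norm x / cmod c"
    by (simp add: norm_scaleC norm_inverse divide_inverse mult.commute)
  then have "norm (inverse c *\<^sub>C x) < 1" using assms c by simp
  then have "two_sided_unit (c *\<^sub>C (1 - inverse c *\<^sub>C x))"
    using c by (intro two_sided_unit_scaleC two_sided_unit_one_minus)
  then show ?thesis using c by (simp add: scaleC.scale_right_diff_distrib)
qed

text \<open>Arens' trick: shift \<open>h\<close> along the imaginary axis until the norm bound excludes \<open>\<i> t\<close>.\<close>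

lemma two_sided_unit_imaginary_minus:
  fixes h :: "'a::complex_cstar_algebra"
  assumes h: "adj h = h" and t: "t \<noteq> 0"
  shows "two_sided_unit ((\<i> * of_real t) *\<^sub>C 1 - h)"
proof -
  \<comment> \<open>With \<open>2 * t * y = (norm h)\<^sup>2\<close>, the square of
    \<open>t + y\<close> exceeds the bound on that of \<open>norm k\<close> by
    \<open>t\<^sup>2\<close>.\<close>
  define y where "y = (norm h)\<^sup>2 / (2 * t)"
  define k where "k = h + (\<i> * of_real y) *\<^sub>C 1"
  have "(\<i> * of_real y) * (\<i> * of_real y) = - complex_of_real (y * y)"
    by (simp add: complex_eq_iff)
  then have "adj k * k = h * h + (y * y) *\<^sub>R 1"
    by (simp add: k_def adj_simps adj_scaleC h distrib_left left_diff_distrib mult_scaleC_left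
        mult_scaleC_right scaleC_scaleC scaleC.scale_right_diff_distrib scaleC_of_real
        del: of_real_mult)
  then have "(norm k)\<^sup>2 \<le> norm (h * h) + norm ((y * y) *\<^sub>R 1 :: 'a)"
    by (metis cstar_identity norm_triangle_ineq)
  also have "\<dots> \<le> (norm h)\<^sup>2 + y\<^sup>2" using norm_mult_ineq[of h h] by (simp add: power2_eq_square)
  also have "\<dots> < (t + y)\<^sup>2" using t by (simp add: power2_sum y_def)
  finally have "norm k < \<bar>t + y\<bar>" using power2_less_imp_less[of "norm k" "\<bar>t + y\<bar>"] by simp
  moreover have "cmod (\<i> * of_real (t + y)) = \<bar>t + y\<bar>" by (simp only: norm_mult norm_of_real) simp
  ultimately have "two_sided_unit ((\<i> * of_real (t + y)) *\<^sub>C 1 - k)"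
    by (intro two_sided_unit_scaleC_one_minus) simp
  then show ?thesis by (simp add: k_def scaleC_add_left distrib_left algebra_simps)
qed

instance complex_cstar_algebra \<subseteq> hermitian_cstar_algebra
proof
  fix h :: 'a assume h: "adj h = h"
  \<comment> \<open>Over the complex numbers \<open>1 + h * h\<close> factors as
    \<open>(\<i> - h) (- \<i> - h)\<close>.\<close>
  have "two_sided_unit (((\<i> * of_real 1) *\<^sub>C 1 - h) * ((\<i> * of_real (- 1)) *\<^sub>C 1 - h))"
    using h by (intro two_sided_unit_mult two_sided_unit_imaginary_minus) auto
  moreover have "((\<i> * of_real 1) *\<^sub>C 1 - h) * ((\<i> * of_real (- 1)) *\<^sub>C 1 - h) = 1 + h * h"
    by (simp add: algebra_simps mult_scaleC_left mult_scaleC_right scaleC_scaleC)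
  ultimately show "\<exists>y. (1 + h * h) * y = 1 \<and> y * (1 + h * h) = 1"
    by (simp add: two_sided_unit_def)
qed

lemma complex_positive_iff: "complex_positive x \<longleftrightarrow> hermitian_positive x"
proof -
  have "two_sided_unit (of_real t + x)" if "complex_spectrum x \<subseteq> \<real>\<^sub>\<ge>\<^sub>0" "t > 0" for t
  proof -
    have "complex_of_real (- t) \<notin> complex_spectrum x"
      using that by (auto simp: complex_nonneg_Reals_iff)
    then show ?thesis
      unfolding complex_spectrum_def by (simp add: scaleC_of_real_one add.commute)
  qed
  moreover have "z \<in> \<real>\<^sub>\<ge>\<^sub>0" if "hermitian_positive x" "z \<in> complex_spectrum x" for z
  proof (rule ccontr)
    assume z: "z \<notin> \<real>\<^sub>\<ge>\<^sub>0"
    define h where "h = x - of_real (Re z)"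
    have h: "adj h = h" using that(1) by (simp add: h_def adj_diff hermitian_positive_def)
    have eq: "x - z *\<^sub>C 1 = - ((\<i> * of_real (Im z)) *\<^sub>C 1 - h)"
      by (subst scaleC_eq_scaleR[of z])
        (simp add: h_def scaleC_imaginary of_real_def[where 'a = 'a])
    have "two_sided_unit (x - z *\<^sub>C 1)"
    proof (cases "Im z = 0")
      case True
      with z have "- Re z > 0" by (simp add: complex_nonneg_Reals_iff)
      then have "two_sided_unit (of_real (- Re z) + x)"
        using that(1) unfolding hermitian_positive_def by blast
      then show ?thesis unfolding eq using True by (simp add: h_def)
    next
      case False
      then show ?thesis
        unfolding eq two_sided_unit_minus_iff using h by (rule two_sided_unit_imaginary_minus[rotated])
    qed
    with that(2) show False by (simp add: complex_spectrum_def)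
  qed
  ultimately show ?thesis unfolding complex_positive_def hermitian_positive_def by blast
qed

text \<open>
  \<open>x\<^sup>*x\<close> and \<open>xx\<^sup>*\<close> have the same nonzero spectrum, and \<open>x\<^sup>*x + xx\<^sup>* = 2(h\<^sup>2 + k\<^sup>2)\<close> for \<open>x = h + \<i>k\<close>.
  If \<open>\<parallel>x\<parallel>\<^sup>2\<close> were not in the spectrum of \<open>x\<^sup>*x\<close>, then \<open>xx\<^sup>* \<le> \<parallel>x\<parallel>\<^sup>2 - \<delta>\<close>, so
  \<open>x\<^sup>*x \<ge> - \<parallel>x\<parallel>\<^sup>2 + \<delta>\<close>, and \<open>x\<^sup>*x\<close> could not attain its norm in its spectrum.
\<close>

lemma complex_norm_square_in_spectrum:
  fixes x :: "'a::complex_cstar_algebra"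
  shows "\<not> two_sided_unit (of_real ((norm x)\<^sup>2) - adj x * x)"
proof (cases "x = 0")
  case True
  then show ?thesis by (simp add: two_sided_unit_def)
next
  case False
  define N where "N = (norm x)\<^sup>2"
  have N: "N > 0" using False by (simp add: N_def)
  show ?thesis
  proof
    assume "two_sided_unit (of_real ((norm x)\<^sup>2) - adj x * x)"
    then have unitN: "two_sided_unit (of_real N - adj x * x)" by (simp add: N_def)
    then obtain \<delta>0 where \<delta>0: "\<delta>0 > 0" "\<And>d. norm d < \<delta>0 \<Longrightarrow> two_sided_unit (of_real N - adj x * x + d)"
      using two_sided_unit_near by blast
    define \<delta> where "\<delta> = min \<delta>0 N / 2"
    have \<delta>: "0 < \<delta>" "\<delta> < \<delta>0" "\<delta> < N" using \<delta>0(1) N by (auto simp: \<delta>_def)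
    have unit: "two_sided_unit (of_real l - adj x * x)" if "l > N - \<delta>" for l
    proof (cases "l > N")
      case True
      then show ?thesis using N
        by (intro two_sided_unit_of_real_minus) (simp add: cstar_identity flip: N_def)
    next
      case False
      with that \<delta> have "norm (of_real (l - N) :: 'a) < \<delta>0" unfolding norm_of_real by linarith
      from \<delta>0(2)[OF this] show ?thesis by simp
    qed
    \<comment> \<open>The spectral gap moves from \<open>adj x * x\<close> to
      \<open>x * adj x\<close>; \<open>\<delta> < N\<close> keeps the scalars nonzero, as the
      exchange requires.\<close>
    have "hermitian_positive (of_real (N - \<delta>) - x * adj x)"
      unfolding hermitian_positive_def
    proof (intro conjI allI impI)
      fix t :: real assume "t > 0"
      then have "two_sided_unit (of_real (t + (N - \<delta>)) - x * adj x)"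
        using \<delta> by (intro two_sided_unit_swap[of _ "adj x" x] unit) auto
      then show "two_sided_unit (of_real t + (of_real (N - \<delta>) - x * adj x))"
        by (simp add: add_diff_eq)
    qed (simp add: adj_diff adj_mult adj_adj del: of_real_diff)
    moreover define h k where "h = (1 / 2) *\<^sub>R (x + adj x)" and "k = (\<i> / 2) *\<^sub>C (x - adj x)"
    have "adj h = h" "adj k = k"
      by (simp_all add: h_def k_def adj_simps adj_scaleC add.commute scaleC.scale_right_diff_distrib)
    then have "hermitian_positive (h * h)" "hermitian_positive (k * k)"
      by (simp_all add: hermitian_positive_square)
    ultimately have "hermitian_positive
        (of_real (N - \<delta>) - x * adj x + (h * h + h * h + (k * k + k * k)))"
      by (intro hermitian_positive_add)
    moreover have "h * h + h * h + (k * k + k * k) = adj x * x + x * adj x"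
    proof -
      have kk: "k * k = (1 / 4) *\<^sub>R (- ((x - adj x) * (x - adj x)))"
        unfolding k_def mult_scaleC_left mult_scaleC_right scaleC_scaleC
        by (simp flip: scaleC_of_real)
      have hh: "h * h = (1 / 4) *\<^sub>R ((x + adj x) * (x + adj x))" by (simp add: h_def)
      have quarters: "(1 / 4) *\<^sub>R v + (1 / 4) *\<^sub>R v = (1 / 2) *\<^sub>R v" for v :: 'a
        by (simp flip: scaleR_add_left)
      have "h * h + h * h + (k * k + k * k)
          = (1 / 2) *\<^sub>R ((x + adj x) * (x + adj x) + - ((x - adj x) * (x - adj x)))"
        unfolding hh kk quarters scaleR_add_right ..
      also have "(x + adj x) * (x + adj x) + - ((x - adj x) * (x - adj x))
          = 2 *\<^sub>R (adj x * x + x * adj x)"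
        unfolding scaleR_2 by (simp add: algebra_simps)
      finally show ?thesis by simp
    qed
    ultimately have "hermitian_positive
        (of_real (N - \<delta>) - x * adj x + (adj x * x + x * adj x))" by simp
    then have "hermitian_positive (of_real (N - \<delta>) + adj x * x)" by (simp add: algebra_simps)
    \<comment> \<open>The shift by \<open>\<delta>\<close> restores \<open>N\<close>, the norm of
      \<open>adj x * x\<close>, and so keeps \<open>- N\<close> out of its spectrum.\<close>
    then have "two_sided_unit (of_real \<delta> + (of_real (N - \<delta>) + adj x * x))"
      using \<delta> unfolding hermitian_positive_def by blast
    moreover have "of_real \<delta> + (of_real (N - \<delta>) + adj x * x) = of_real (norm (adj x * x)) + adj x * x"
      by (simp add: cstar_identity flip: N_def)
    ultimately have "two_sided_unit (of_real (norm (adj x * x)) + adj x * x)" by simp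
    then have "\<not> two_sided_unit (of_real (norm (adj x * x)) - adj x * x)"
      by (intro norm_in_spectrum_self_adjoint) (simp_all add: adj_mult adj_adj)
    with unitN show False by (simp add: cstar_identity flip: N_def)
  qed
qed

section \<open>Complex functionals and their real parts\<close>

lemma complex_linear_iff:
  "complex_linear \<phi> \<longleftrightarrow> (\<forall>x y. \<phi> (x + y) = \<phi> x + \<phi> y) \<and> (\<forall>c x. \<phi> (c *\<^sub>C x) = c * \<phi> x)"
proof -
  have "vector_space ((*) :: complex \<Rightarrow> _)" by unfold_locales (simp_all add: algebra_simps)
  then show ?thesis
    by (simp add: Vector_Spaces.linear_iff vector_space_scaleC)
qed

text \<open>A complex-linear functional satisfies
  \<open>Im (\<phi> x) = - Re (\<phi> (\<i> x))\<close>, so this is the only candidate with real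
  part \<open>f\<close>.\<close>

lemma complex_linear_complexify:
  assumes f: "linear (f :: 'a::complex_cstar_algebra \<Rightarrow> real)"
  shows "complex_linear (\<lambda>x. Complex (f x) (- f (\<i> *\<^sub>C x)))"
  unfolding complex_linear_iff
proof (intro conjI allI)
  fix x y and c :: complex
  show "Complex (f (x + y)) (- f (\<i> *\<^sub>C (x + y)))
      = Complex (f x) (- f (\<i> *\<^sub>C x)) + Complex (f y) (- f (\<i> *\<^sub>C y))"
    using f by (simp add: scaleC_add_right linear_add complex_eq_iff)
  have "f (c *\<^sub>C x) = Re c * f x + Im c * f (\<i> *\<^sub>C x)"
    by (subst scaleC_eq_scaleR[of c]) (use f in \<open>simp add: linear_add linear_scale\<close>)
  moreover have "f (\<i> *\<^sub>C c *\<^sub>C x) = Re c * f (\<i> *\<^sub>C x) - Im c * f x"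
  proof -
    have "\<i> *\<^sub>C c *\<^sub>C x = Re c *\<^sub>R \<i> *\<^sub>C x - Im c *\<^sub>R x"
      by (subst scaleC_eq_scaleR[of c])
        (simp add: scaleC_add_right scaleC_scaleR scaleC_scaleC)
    then show ?thesis using f by (simp add: linear_diff linear_scale)
  qed
  ultimately show "Complex (f (c *\<^sub>C x)) (- f (\<i> *\<^sub>C c *\<^sub>C x)) = c * Complex (f x) (- f (\<i> *\<^sub>C x))"
    by (simp add: complex_eq_iff)
qed

lemma birkhoff_james_iff_complex_state:
  fixes a :: "'a::complex_cstar_algebra"
  assumes B: "complex_subspace B"
  shows "birkhoff_james_orthogonal a B \<longleftrightarrow>
    (\<exists>\<phi>. complex_state \<phi> \<and> \<phi> (adj a * a) = complex_of_real ((norm a)\<^sup>2) \<and>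
      (\<forall>b\<in>B. \<phi> (adj a * b) = 0))"
proof
  assume orth: "birkhoff_james_orthogonal a B"
  have "subspace B"
    using scaleC.subspace_0[OF B] scaleC.subspace_add[OF B] scaleC.subspace_scale[OF B]
    by (metis subspaceI scaleC_of_real)
  then obtain f where f: "linear f" "\<And>x. f x \<le> norm x" "f 1 = 1" "f (adj a * a) = (norm a)\<^sup>2"
    "\<And>b. b \<in> B \<Longrightarrow> f (adj a * b) = 0"
    using birkhoff_james_functional[OF one_plus_norm_le[OF complex_norm_square_in_spectrum] _ orth]
    by blast
  define \<phi> where "\<phi> = (\<lambda>x. Complex (f x) (- f (\<i> *\<^sub>C x)))"
  \<comment> \<open>For self-adjoint \<open>h\<close> the element \<open>\<i> h\<close> is skew, so
    \<open>f\<close> kills it.\<close>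
  have real: "\<phi> h = complex_of_real (f h)" if "adj h = h" for h
    using functional_skew_adjoint[OF f(1-3), of "\<i> *\<^sub>C h"] that
    by (simp add: \<phi>_def adj_scaleC complex_eq_iff)
  have "complex_state \<phi>"
    unfolding complex_state_def complex_positive_iff
  proof (intro conjI allI impI)
    show "complex_linear \<phi>" unfolding \<phi>_def by (rule complex_linear_complexify[OF f(1)])
    show "\<phi> 1 = 1" using f(3) by (simp add: real)
    fix y :: 'a assume y: "hermitian_positive y"
    then have "adj y = y" by (simp add: hermitian_positive_def)
    then show "\<phi> y \<in> \<real>\<^sub>\<ge>\<^sub>0" using functional_positive[OF f(1-3) y] by (simp add: real)
  qed
  moreover have "\<phi> (adj a * a) = complex_of_real ((norm a)\<^sup>2)"
    using f(4) by (subst real) (simp_all add: adj_mult adj_adj)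
  \<comment> \<open>\<open>B\<close> also contains \<open>\<i> b\<close>, which takes care of the
    imaginary part.\<close>
  moreover have "\<phi> (adj a * b) = 0" if "b \<in> B" for b
    using f(5)[OF that] f(5)[OF scaleC.subspace_scale[OF B that, of \<i>]]
    by (simp add: \<phi>_def mult_scaleC_right complex_eq_iff)
  ultimately show "\<exists>\<phi>. complex_state \<phi> \<and> \<phi> (adj a * a) = complex_of_real ((norm a)\<^sup>2) \<and>
      (\<forall>b\<in>B. \<phi> (adj a * b) = 0)" by blast
next
  assume "\<exists>\<phi>. complex_state \<phi> \<and> \<phi> (adj a * a) = complex_of_real ((norm a)\<^sup>2) \<and>
      (\<forall>b\<in>B. \<phi> (adj a * b) = 0)"
  then obtain \<phi> where lin: "complex_linear \<phi>" and one: "\<phi> 1 = 1"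
    and pos: "\<And>y. hermitian_positive y \<Longrightarrow> \<phi> y \<in> \<real>\<^sub>\<ge>\<^sub>0"
    and a: "\<phi> (adj a * a) = complex_of_real ((norm a)\<^sup>2)" "\<And>b. b \<in> B \<Longrightarrow> \<phi> (adj a * b) = 0"
    unfolding complex_state_def complex_positive_iff by blast
  have add: "\<phi> (x + y) = \<phi> x + \<phi> y" and scaleC: "\<phi> (c *\<^sub>C x) = c * \<phi> x" for x y c
    using lin by (auto simp: complex_linear_iff)
  have scaleR: "\<phi> (r *\<^sub>R x) = r *\<^sub>R \<phi> x" for r x
    using scaleC[of "complex_of_real r" x] by (simp add: scaleC_of_real scaleR_conv_of_real)
  have diff: "\<phi> (x - y) = \<phi> x - \<phi> y" for x y
    using add[of "x - y" y] by simp
  define f where "f = (\<lambda>x. Re (\<phi> x))"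
  have f: "linear f" unfolding f_def by (intro linearI) (simp_all add: add scaleR)
  have f1: "f 1 = 1" by (simp add: f_def one)
  have fpos: "f y \<ge> 0" if "hermitian_positive y" for y
    using pos[OF that] by (simp add: f_def complex_nonneg_Reals_iff)
  have fadj: "f (adj x) = f x" for x
  proof -
    \<comment> \<open>\<open>\<phi>\<close> is real at the self-adjoint \<open>h\<close>, since
      \<open>norm h - h\<close> is positive; the factor \<open>\<i>\<close> turns this into
      vanishing of the real part at \<open>x - adj x\<close>.\<close>
    define h where "h = \<i> *\<^sub>C (x - adj x)"
    have "adj h = h" by (simp add: h_def adj_scaleC adj_simps scaleC.scale_right_diff_distrib)
    then have "\<phi> (of_real (norm h) - h) \<in> \<real>\<^sub>\<ge>\<^sub>0" by (intro pos hermitian_positive_norm_minus)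
    then have "Im (\<phi> h) = 0" by (simp add: complex_nonneg_Reals_iff diff of_real_def scaleR one)
    then show ?thesis by (simp add: h_def scaleC diff f_def)
  qed
  show "birkhoff_james_orthogonal a B"
    using f positive_functional_le_norm[OF f f1 fadj fpos]
    by (rule birkhoff_james_if_functional) (simp_all add: f_def a)
qed

theorem corollary1p3:
  "(\<forall>(a :: 'a::real_cstar_algebra) B. subspace B \<longrightarrow>
      (birkhoff_james_orthogonal a B \<longleftrightarrow>
        (\<exists>\<phi>. real_state \<phi> \<and> \<phi> (adj a * a) = (norm a)\<^sup>2 \<and> (\<forall>b\<in>B. \<phi> (adj a * b) = 0)))) \<and>
   (\<forall>(a :: 'b::complex_cstar_algebra) B. complex_subspace B \<longrightarrow>
      (birkhoff_james_orthogonal a B \<longleftrightarrow>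
        (\<exists>\<phi>. complex_state \<phi> \<and> \<phi> (adj a * a) = complex_of_real ((norm a)\<^sup>2) \<and>
          (\<forall>b\<in>B. \<phi> (adj a * b) = 0))))"
  by (intro conjI allI impI birkhoff_james_iff_real_state birkhoff_james_iff_complex_state)

end
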